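(* Let $0<\alpha<1$ and $0\le\eta<1$. Assume that $x\in AC[0,\infty)$ and $\mathfrak{I}_0^{1-\alpha}x'\in C^1_\eta[0,\infty)$. Then $$\lim_{\tau\to\infty}\frac{x(\tau)}{\tau^\alpha}=\lim_{\tau\to\infty}\frac{{}^C\mathfrak{D}_0^\alpha x(\tau)}{\Gamma(1+\alpha)} .$$
   Context: $AC[0,\infty)$ denotes the functions $x:[0,\infty)\to\mathbb{R}$ that are absolutely continuous on every compact interval $[0,T]$. For $\mu>0$ the Riemann-Liouville fractional integral is $\mathfrak{I}_0^\mu g(\tau)=\frac{1}{\Gamma(\mu)}\int_0^\tau (\tau-s)^{\mu-1}g(s)\,ds$, $\tau>0$. For $0<\alpha<1$ the Caputo fractional derivative is ${}^C\mathfrak{D}_0^\alpha x(\tau)=\mathfrak{I}_0^{1-\alpha}x'(\tau)$, $\tau>0$. For $0\le\eta<1$, $C_\eta[0,\infty)$ is the set of functions $h:(0,\infty)\to\mathbb{R}$ such that $\tau\mapsto\tau^\eta h(\tau)$ is continuous on $[0,\infty)$ (i.e. is continuous on $(0,\infty)$ and extends continuously to $0$). $C^1_\eta[0,\infty)$ is the set of functions $g$ that are continuous on $[0,\infty)$ (a function given on $(0,\infty)$ being extended to $0$ by its limit) and differentiable on $(0,\infty)$ with $g'\in C_\eta[0,\infty)$. *)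

theory Defs
  imports "HOL-Analysis.Analysis"
begin

text \<open>Functions on \<open>[0,\<infinity>)\<close> or \<open>(0,\<infinity>)\<close> are total functions on the reals; none of the notions below
  depends on values outside the respective domain (up to null sets under integrals).\<close>

definition abs_continuous_on_interval :: "real \<Rightarrow> real \<Rightarrow> (real \<Rightarrow> real) \<Rightarrow> bool" where
  "abs_continuous_on_interval a b x \<longleftrightarrow>
     (\<forall>\<epsilon>>0. \<exists>\<delta>>0. \<forall>(n::nat) (u::nat \<Rightarrow> real) (v::nat \<Rightarrow> real).
        (\<forall>i<n. a \<le> u i \<and> u i \<le> v i \<and> v i \<le> b) \<longrightarrow>
        disjoint_family_on (\<lambda>i. {u i<..<v i}) {..<n} \<longrightarrow>
        (\<Sum>i<n. v i - u i) < \<delta> \<longrightarrow>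
        (\<Sum>i<n. \<bar>x (v i) - x (u i)\<bar>) < \<epsilon>)"

definition AC_halfline :: "(real \<Rightarrow> real) set" where
  "AC_halfline = {x. \<forall>T>0. abs_continuous_on_interval 0 T x}"

definition RL_integral :: "real \<Rightarrow> (real \<Rightarrow> real) \<Rightarrow> real \<Rightarrow> real" where
  "RL_integral \<mu> g \<tau> =
     1 / Gamma \<mu> * (LINT s:{0..\<tau>}|lebesgue. (\<tau> - s) powr (\<mu> - 1) * g s)"

text \<open>For locally absolutely continuous \<open>x\<close> the derivative exists almost everywhere; the
  unspecified value of \<^const>\<open>deriv\<close> on the exceptional null set does not affect the integral.\<close>

definition caputo_deriv :: "real \<Rightarrow> (real \<Rightarrow> real) \<Rightarrow> real \<Rightarrow> real" where
  "caputo_deriv \<alpha> x \<tau> = RL_integral (1 - \<alpha>) (deriv x) \<tau>"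

text \<open>Continuity on \<open>[0,\<infinity>)\<close> of a function given on \<open>(0,\<infinity>)\<close> and extended to \<open>0\<close> by its limit;
  the value \<open>f 0\<close> itself is irrelevant.\<close>

definition continuous_extends_to_0 :: "(real \<Rightarrow> real) \<Rightarrow> bool" where
  "continuous_extends_to_0 f \<longleftrightarrow>
     continuous_on {0<..} f \<and> (\<exists>l. (f \<longlongrightarrow> l) (at_right 0))"

definition C_weighted :: "real \<Rightarrow> (real \<Rightarrow> real) set" where
  "C_weighted \<eta> = {h. continuous_extends_to_0 (\<lambda>\<tau>. \<tau> powr \<eta> * h \<tau>)}"

definition C1_weighted :: "real \<Rightarrow> (real \<Rightarrow> real) set" where
  "C1_weighted \<eta> =
     {g. continuous_extends_to_0 g \<and> (\<forall>\<tau>>0. g differentiable (at \<tau>)) \<and> deriv g \<in> C_weighted \<eta>}"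

end

theory Submission
  imports Defs
begin

text \<open>
Write \<open>g = \<^sup>CD\<^sup>\<alpha> x\<close> for the Caputo derivative and \<open>I\<^sup>\<mu>\<close> for the Riemann--Liouville integral. Applying
\<open>I\<^sup>\<alpha>\<close> to \<open>g = I\<^bsup>1-\<alpha>\<^esup> x'\<close> gives back \<open>x\<close> up to its initial value, because \<open>I\<^sup>\<alpha> I\<^bsup>1-\<alpha>\<^esup> = I\<^sup>1\<close> and an
absolutely continuous function is the integral of its derivative:
\<open>\<Gamma>(\<alpha>) (x(t) - x(0)) = \<integral>\<^sub>0\<^sup>t (t - s)\<^bsup>\<alpha>-1\<^esup> g(s) ds\<close>.
The kernel has total mass \<open>t\<^sup>\<alpha> / \<alpha>\<close>, so \<open>\<Gamma>(1+\<alpha>) (x(t) - x(0)) / t\<^sup>\<alpha>\<close> is a weighted average of \<open>g\<close> over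
\<open>[0, t]\<close>. Any fixed initial segment \<open>[0, T]\<close> carries a vanishing share of the weight as \<open>t\<close> grows, and
\<open>g\<close> is bounded there, being continuous with a limit at \<open>0\<close>. Hence the averages have the same limit
as \<open>g\<close>, be it finite or infinite; this is lemma \<open>kernel_average_eventually_greater\<close>, applied to \<open>g\<close>
and to \<open>-g\<close>. The remaining term \<open>x(0) / t\<^sup>\<alpha>\<close> tends to \<open>0\<close>.

The identity for \<open>x(t) - x(0)\<close> rests on two facts.

\<^item> The fundamental theorem of calculus for absolutely continuous functions (lemmas
  \<open>abs_continuous_deriv_has_integral\<close> and \<open>abs_continuous_deriv_absolutely_integrable\<close>). An absolutely
  continuous function has bounded variation, so it is a difference of monotone functions, and these
  are differentiable almost everywhere by Lebesgue's theorem (\<open>mono_ae_differentiable\<close>), which is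
  derived from Vitali's covering theorem. Once the derivative is known to exist off a null set, the
  Henstock--Kurzweil description of the integral makes the theorem direct: the gauge controls the
  difference quotients off the null set, and absolute continuity controls the increments over the
  few short intervals tagged inside it.

\<^item> The composition rule for fractional integrals (lemma \<open>RL_integral_inversion\<close>): by Fubini, the inner
  kernel integral is the constant Beta integral \<open>\<Gamma>(\<alpha>) \<Gamma>(1-\<alpha>)\<close>.
\<close>

section \<open>Absolute continuity and bounded variation\<close>

lemma sum_lengths_le_measure:
  fixes u v :: "'i \<Rightarrow> real"
  assumes "finite I" and le: "\<And>i. i \<in> I \<Longrightarrow> u i \<le> v i"
    and disj: "disjoint_family_on (\<lambda>i. {u i<..<v i}) I"
    and sub: "\<And>i. i \<in> I \<Longrightarrow> {u i<..<v i} \<subseteq> S" and S: "S \<in> lmeasurable"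
  shows "(\<Sum>i\<in>I. v i - u i) \<le> measure lebesgue S"
proof -
  have "(\<Sum>i\<in>I. v i - u i) = (\<Sum>i\<in>I. measure lebesgue {u i<..<v i})"
    by (intro sum.cong) (use le in auto)
  also have "\<dots> = measure lebesgue (\<Union>i\<in>I. {u i<..<v i})"
    by (rule measure_finite_Union[symmetric])
       (use assms in \<open>auto simp: emeasure_lborel_Ioo\<close>)
  also have "\<dots> \<le> measure lebesgue S"
    by (rule measure_mono_fmeasurable) (use sub S in \<open>auto simp: \<open>finite I\<close>\<close>)
  finally show ?thesis .
qed

text \<open>Families indexed by arbitrary finite sets, so that tagged divisions and sets of intervals
can serve as their own index sets below.\<close>

lemma abs_continuous_finite_family:
  fixes f :: "real \<Rightarrow> real"
  assumes "abs_continuous_on_interval a b f" and "\<epsilon> > 0"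
  obtains \<delta> where "\<delta> > 0"
    and "\<And>(I :: 'i set) u v.
      \<lbrakk>finite I; \<And>i. i \<in> I \<Longrightarrow> a \<le> u i \<and> u i \<le> v i \<and> v i \<le> b;
       disjoint_family_on (\<lambda>i. {u i<..<v i}) I; (\<Sum>i\<in>I. v i - u i) < \<delta>\<rbrakk>
      \<Longrightarrow> (\<Sum>i\<in>I. \<bar>f (v i) - f (u i)\<bar>) < \<epsilon>"
proof -
  obtain \<delta> where "\<delta> > 0" and \<delta>: "\<And>(n::nat) u v.
        (\<forall>i<n. a \<le> u i \<and> u i \<le> v i \<and> v i \<le> b) \<Longrightarrow>
        disjoint_family_on (\<lambda>i. {u i<..<v i}) {..<n} \<Longrightarrow>
        (\<Sum>i<n. v i - u i) < \<delta> \<Longrightarrow> (\<Sum>i<n. \<bar>f (v i) - f (u i)\<bar>) < \<epsilon>"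
    using assms unfolding abs_continuous_on_interval_def by meson
  show ?thesis
  proof (rule that[OF \<open>\<delta> > 0\<close>])
    fix I :: "'i set" and u v
    assume I: "finite I" "\<And>i. i \<in> I \<Longrightarrow> a \<le> u i \<and> u i \<le> v i \<and> v i \<le> b"
      "disjoint_family_on (\<lambda>i. {u i<..<v i}) I" "(\<Sum>i\<in>I. v i - u i) < \<delta>"
    obtain h where h: "bij_betw h {..<card I} I"
      using ex_bij_betw_nat_finite[OF \<open>finite I\<close>] by (auto simp: atLeast0LessThan)
    have hI: "h i \<in> I" if "i < card I" for i
      using h that by (auto simp: bij_betw_def)
    have "(\<Sum>i<card I. \<bar>f ((v \<circ> h) i) - f ((u \<circ> h) i)\<bar>) < \<epsilon>"
    proof (rule \<delta>)
      show "disjoint_family_on (\<lambda>i. {(u \<circ> h) i<..<(v \<circ> h) i}) {..<card I}"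
        unfolding disjoint_family_on_def o_def
      proof (intro ballI impI)
        fix m n assume mn: "m \<in> {..<card I}" "n \<in> {..<card I}" "m \<noteq> n"
        then have "h m \<noteq> h n"
          using h by (auto simp: bij_betw_def dest: inj_onD)
        then show "{u (h m)<..<v (h m)} \<inter> {u (h n)<..<v (h n)} = {}"
          using disjoint_family_onD[OF I(3) hI hI] mn by auto
      qed
      show "(\<Sum>i<card I. (v \<circ> h) i - (u \<circ> h) i) < \<delta>"
        using I(4) sum.reindex_bij_betw[OF h, of "\<lambda>i. v i - u i"] by simp
    qed (use I(2) hI in auto)
    then show "(\<Sum>i\<in>I. \<bar>f (v i) - f (u i)\<bar>) < \<epsilon>"
      using sum.reindex_bij_betw[OF h, of "\<lambda>i. \<bar>f (v i) - f (u i)\<bar>"] by simp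
  qed
qed

text \<open>Cut \<open>[a, b]\<close> into \<open>N\<close> cells shorter than the \<open>\<delta>\<close> that belongs to \<open>\<epsilon> = 1\<close>. The part of a family
of intervals lying in one cell has total variation below \<open>1\<close>, so the whole has at most \<open>N\<close>. An
interval is cut at the cell boundaries by clipping both of its endpoints to the cell, which
keeps the index set unchanged.\<close>

lemma abs_continuous_bounded_variation:
  fixes f :: "real \<Rightarrow> real"
  assumes ac: "abs_continuous_on_interval a b f" and "a \<le> b"
  obtains B where
    "\<And>(I :: 'i set) u v.
      \<lbrakk>finite I; \<And>i. i \<in> I \<Longrightarrow> a \<le> u i \<and> u i \<le> v i \<and> v i \<le> b;
       disjoint_family_on (\<lambda>i. {u i<..<v i}) I\<rbrakk>
      \<Longrightarrow> (\<Sum>i\<in>I. \<bar>f (v i) - f (u i)\<bar>) \<le> B"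
proof -
  obtain \<delta> where "\<delta> > 0" and \<delta>: "\<And>(I :: 'i set) u v.
      \<lbrakk>finite I; \<And>i. i \<in> I \<Longrightarrow> a \<le> u i \<and> u i \<le> v i \<and> v i \<le> b;
       disjoint_family_on (\<lambda>i. {u i<..<v i}) I; (\<Sum>i\<in>I. v i - u i) < \<delta>\<rbrakk>
      \<Longrightarrow> (\<Sum>i\<in>I. \<bar>f (v i) - f (u i)\<bar>) < 1"
    using abs_continuous_finite_family[OF ac zero_less_one] by blast
  obtain N :: nat where N: "(b - a) / \<delta> < real N"
    using reals_Archimedean2 by blast
  have "0 \<le> (b - a) / \<delta>"
    using \<open>a \<le> b\<close> \<open>\<delta> > 0\<close> by simp
  with N have "N > 0"
    by (metis of_nat_0_less_iff order_le_less_trans)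
  define h where "h = (b - a) / N"
  have h: "0 \<le> h" "h < \<delta>"
    using N \<open>N > 0\<close> \<open>\<delta> > 0\<close> \<open>a \<le> b\<close> by (auto simp: h_def field_simps)
  define t where "t k = a + real k * h" for k
  have t0: "t 0 = a" and tN: "t N = b"
    using \<open>N > 0\<close> by (auto simp: t_def h_def)
  have tSuc: "t k \<le> t (Suc k)" "t (Suc k) - t k = h" for k
    using h by (auto simp: t_def algebra_simps)
  have t_mono: "t k \<le> t l" if "k \<le> l" for k l
    using that h by (auto simp: t_def intro!: mult_right_mono)
  define clip where "clip k y = max (t k) (min y (t (Suc k)))" for k y
  have telescope: "(\<Sum>k<m. f (clip k y) - f (t k)) = f (min y (t m)) - f a" if "a \<le> y" for y m
  proof (induction m)
    case 0
    then show ?case using that by (simp add: t0 min_absorb2)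
  next
    case (Suc m)
    have "f (min y (t m)) + f (clip m y) = f (min y (t (Suc m))) + f (t m)"
      using tSuc(1)[of m] by (cases "y \<le> t m") (auto simp: clip_def min_def max_def)
    with Suc show ?case by simp
  qed
  show ?thesis
  proof (rule that[of "real N"])
    fix I :: "'i set" and u v
    assume I: "finite I" "\<And>i. i \<in> I \<Longrightarrow> a \<le> u i \<and> u i \<le> v i \<and> v i \<le> b"
      "disjoint_family_on (\<lambda>i. {u i<..<v i}) I"
    have "(\<Sum>i\<in>I. \<bar>f (v i) - f (u i)\<bar>)
        \<le> (\<Sum>i\<in>I. \<Sum>k<N. \<bar>f (clip k (v i)) - f (clip k (u i))\<bar>)"
    proof (rule sum_mono)
      fix i assume i: "i \<in> I"
      have "f y - f a = (\<Sum>k<N. f (clip k y) - f (t k))" if "a \<le> y" "y \<le> b" for y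
        using telescope[of y N] that by (simp add: tN min_absorb1)
      from this[of "v i"] this[of "u i"] I(2)[OF i]
      have "f (v i) - f (u i) = (\<Sum>k<N. f (clip k (v i)) - f (clip k (u i)))"
        by (simp add: sum_subtractf)
      then show "\<bar>f (v i) - f (u i)\<bar> \<le> (\<Sum>k<N. \<bar>f (clip k (v i)) - f (clip k (u i))\<bar>)"
        by simp
    qed
    also have "\<dots> = (\<Sum>k<N. \<Sum>i\<in>I. \<bar>f (clip k (v i)) - f (clip k (u i))\<bar>)"
      by (rule sum.swap)
    also have "\<dots> \<le> (\<Sum>k<N. 1)"
    proof (intro sum_mono less_imp_le \<delta>)
      fix k assume k: "k \<in> {..<N}"
      have tk: "a \<le> t k" "t (Suc k) \<le> b"
        using t_mono[of 0 k] t_mono[of "Suc k" N] k by (auto simp: t0 tN)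
      show clip: "a \<le> clip k (u i) \<and> clip k (u i) \<le> clip k (v i) \<and> clip k (v i) \<le> b"
        if "i \<in> I" for i
        using tk tSuc[of k] I(2)[OF that] by (auto simp: clip_def)
      have sub: "{clip k (u i)<..<clip k (v i)} \<subseteq> {u i<..<v i} \<inter> {t k<..<t (Suc k)}" for i
        by (auto simp: clip_def)
      show disj: "disjoint_family_on (\<lambda>i. {clip k (u i)<..<clip k (v i)}) I"
        using I(3) sub unfolding disjoint_family_on_def by blast
      have "(\<Sum>i\<in>I. clip k (v i) - clip k (u i)) \<le> measure lebesgue {t k<..<t (Suc k)}"
        by (rule sum_lengths_le_measure) (use I(1) clip disj sub in blast)+
      then show "(\<Sum>i\<in>I. clip k (v i) - clip k (u i)) < \<delta>"
        using tSuc[of k] h by simp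
    qed (use I in auto)
    finally show "(\<Sum>i\<in>I. \<bar>f (v i) - f (u i)\<bar>) \<le> real N"
      by simp
  qed
qed

text \<open>\<open>P\<close> is the positive variation: \<open>P x\<close> is the supremum of the total gain of \<open>f\<close> over finite families
of disjoint intervals in \<open>[a, x]\<close>.\<close>

lemma abs_continuous_Jordan_decomposition:
  fixes f :: "real \<Rightarrow> real"
  assumes ac: "abs_continuous_on_interval a b f" and "a \<le> b"
  obtains P where "mono_on {a..b} P" and "mono_on {a..b} (\<lambda>x. P x - f x)"
proof -
  define fam where "fam x n u v \<longleftrightarrow> (\<forall>i<n. a \<le> u i \<and> u i \<le> v i \<and> v i \<le> x) \<and>
      disjoint_family_on (\<lambda>i. {u i<..<v i}) {..<n}" for x and n :: nat and u v :: "nat \<Rightarrow> real"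
  define gains where "gains x = {\<Sum>i<n. f (v i) - f (u i) | n u v. fam x n u v}" for x
  define P where "P x = Sup (gains x)" for x
  obtain B where B: "\<And>(I :: nat set) u v.
      \<lbrakk>finite I; \<And>i. i \<in> I \<Longrightarrow> a \<le> u i \<and> u i \<le> v i \<and> v i \<le> b;
       disjoint_family_on (\<lambda>i. {u i<..<v i}) I\<rbrakk>
      \<Longrightarrow> (\<Sum>i\<in>I. \<bar>f (v i) - f (u i)\<bar>) \<le> B"
    using abs_continuous_bounded_variation[OF assms] by blast
  have bdd: "bdd_above (gains x)" if "x \<le> b" for x
  proof (rule bdd_aboveI)
    fix y assume "y \<in> gains x"
    then obtain n u v where y: "y = (\<Sum>i<n. f (v i) - f (u i))" and "fam x n u v"
      by (auto simp: gains_def)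
    then have "(\<Sum>i<n. \<bar>f (v i) - f (u i)\<bar>) \<le> B"
      using that by (intro B) (auto simp: fam_def intro: order_trans)
    moreover have "y \<le> (\<Sum>i<n. \<bar>f (v i) - f (u i)\<bar>)"
      unfolding y by (intro sum_mono) auto
    ultimately show "y \<le> B" by simp
  qed
  have zero: "0 \<in> gains x" for x
  proof -
    have "fam x 0 (\<lambda>_. 0) (\<lambda>_. 0)" by (auto simp: fam_def disjoint_family_on_def)
    then show ?thesis unfolding gains_def by force
  qed
  have mono: "P x \<le> P y" if "x \<le> y" "y \<le> b" for x y
    unfolding P_def
  proof (rule cSup_subset_mono)
    show "gains x \<subseteq> gains y"
    proof -
      have "fam y n u v" if "fam x n u v" for n u v
        using that order_trans[OF _ \<open>x \<le> y\<close>] unfolding fam_def by blast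
      then show ?thesis unfolding gains_def by blast
    qed
  qed (use bdd zero that in auto)
  \<comment> \<open>Appending the interval from \<open>x\<close> to \<open>y\<close> to a family on the left of \<open>x\<close>.\<close>
  have step: "P x + (f y - f x) \<le> P y" if xy: "a \<le> x" "x \<le> y" "y \<le> b" for x y
  proof -
    have "z \<le> P y - (f y - f x)" if zx: "z \<in> gains x" for z
    proof -
      obtain n u v where z: "z = (\<Sum>i<n. f (v i) - f (u i))" and fam: "fam x n u v"
        using zx unfolding gains_def by blast
      have "fam y (Suc n) (u(n := x)) (v(n := y))"
        unfolding fam_def
      proof
        show "\<forall>i<Suc n. a \<le> (u(n := x)) i \<and> (u(n := x)) i \<le> (v(n := y)) i \<and> (v(n := y)) i \<le> y"
          using fam xy by (auto simp: fam_def less_Suc_eq intro: order_trans)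
        have "{u i<..<v i} \<inter> {x<..<y} = {}" if "i < n" for i
          using fam that by (force simp: fam_def)
        then show "disjoint_family_on (\<lambda>i. {(u(n := x)) i<..<(v(n := y)) i}) {..<Suc n}"
          using fam unfolding fam_def disjoint_family_on_def
          by (auto simp: less_Suc_eq Int_commute)
      qed
      moreover have "(\<Sum>i<Suc n. f ((v(n := y)) i) - f ((u(n := x)) i)) = z + (f y - f x)"
        unfolding z by simp
      ultimately have "z + (f y - f x) \<in> gains y"
        unfolding gains_def mem_Collect_eq by metis
      then have "z + (f y - f x) \<le> P y"
        unfolding P_def using bdd[OF \<open>y \<le> b\<close>] by (rule cSup_upper)
      then show ?thesis by simp
    qed
    then have "P x \<le> P y - (f y - f x)"
      using zero[of x] unfolding P_def[of x] by (intro cSup_least) auto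
    then show ?thesis by simp
  qed
  show ?thesis
  proof (rule that[of P])
    show "mono_on {a..b} P"
      by (rule mono_onI) (use mono in auto)
    show "mono_on {a..b} (\<lambda>x. P x - f x)"
      by (rule mono_onI) (use step in force)
  qed
qed

section \<open>Differentiability of monotone functions\<close>

lemma lmeasurable_outer_open:
  fixes S :: "'a::euclidean_space set"
  assumes "S \<in> lmeasurable" and "e > 0"
  obtains T where "open T" "S \<subseteq> T" "T \<in> lmeasurable" "measure lebesgue T < measure lebesgue S + e"
proof -
  obtain T where T: "open T" "S \<subseteq> T" "T - S \<in> lmeasurable" "emeasure lebesgue (T - S) < ennreal e"
    using sets_lebesgue_outer_open[of S e] assms by (auto simp: fmeasurableD)
  have "measure lebesgue (T - S) < e"
    using T(3,4) by (metis emeasure_eq_measure2 ennreal_leI not_less)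
  moreover have "T = S \<union> (T - S)"
    using T by auto
  moreover have "S \<union> (T - S) \<in> lmeasurable"
    using assms T by (intro fmeasurable.Un) auto
  ultimately have "T \<in> lmeasurable" "measure lebesgue T \<le> measure lebesgue S + measure lebesgue (T - S)"
    using measure_Un_le[of S lebesgue "T - S"] assms T(3) by (auto simp: fmeasurableD)
  then show ?thesis
    using that[of T] T \<open>measure lebesgue (T - S) < e\<close> by auto
qed

text \<open>The hypothesis of Vitali's theorem at \<open>x\<close>. The point may be an endpoint of the intervals, so
that a difference quotient at \<open>x\<close> is the slope over an admissible interval.\<close>

definition finely_covered :: "(real \<Rightarrow> real \<Rightarrow> bool) \<Rightarrow> real \<Rightarrow> bool" where
  "finely_covered Q x \<longleftrightarrow> (\<forall>d>0. \<exists>u v. u < v \<and> v - u < d \<and> u \<le> x \<and> x \<le> v \<and> Q u v)"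

text \<open>A finite form of Vitali's theorem for intervals selected by a property \<open>Q\<close>: finitely many
disjoint ones cover \<open>E\<close> up to a set \<open>W\<close> of small measure. Using open intervals in the covering
costs only finitely many endpoints, and lets the lemma be applied again inside their union.\<close>

lemma finite_Vitali_covering_intervals:
  assumes "open U" "U \<in> lmeasurable" "E \<subseteq> U"
    and fine: "\<And>x. x \<in> E \<Longrightarrow> finely_covered Q x" and "\<epsilon> > 0"
  obtains D W where "finite D"
    and "\<And>u v. (u, v) \<in> D \<Longrightarrow> u < v \<and> {u..v} \<subseteq> U \<and> Q u v"
    and "disjoint_family_on (\<lambda>p. {fst p..snd p}) D"
    and "W \<in> lmeasurable" "measure lebesgue W < \<epsilon>"
    and "E \<subseteq> (\<Union>p\<in>D. {fst p<..<snd p}) \<union> W"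
proof -
  define K where "K = {p. fst p < snd p \<and> {fst p..snd p} \<subseteq> U \<and> Q (fst p) (snd p)}"
  define c where "c p = (fst p + snd p) / 2" for p :: "real \<times> real"
  define r where "r p = (snd p - fst p) / 2" for p :: "real \<times> real"
  have ball: "cball (c p) (r p) = {fst p..snd p}" for p
    unfolding cball_eq_atLeastAtMost c_def r_def by (auto simp: field_simps)
  have "\<exists>p. p \<in> K \<and> x \<in> cball (c p) (r p) \<and> r p < d" if x: "x \<in> E" and "d > 0" for x d
  proof -
    obtain e where e: "e > 0" "ball x e \<subseteq> U"
      using \<open>open U\<close> \<open>E \<subseteq> U\<close> x openE by blast
    obtain u v where uv: "u < v" "v - u < min d e" "u \<le> x" "x \<le> v" "Q u v"
      using fine[OF x] \<open>d > 0\<close> e(1) unfolding finely_covered_def by (metis min_less_iff_conj)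
    have "{u..v} \<subseteq> ball x e"
      using uv by (auto simp: dist_real_def)
    then have "(u, v) \<in> K"
      using uv e(2) by (auto simp: K_def)
    moreover have "x \<in> cball (c (u, v)) (r (u, v))"
      unfolding ball using uv by auto
    moreover have "r (u, v) < d"
      using uv by (auto simp: r_def)
    ultimately show ?thesis by blast
  qed
  moreover have "0 < r p" if "p \<in> K" for p
    using that by (auto simp: K_def r_def)
  ultimately obtain C where C: "countable C" "C \<subseteq> K"
      "pairwise (\<lambda>i j. disjnt (cball (c i) (r i)) (cball (c j) (r j))) C"
      "negligible (E - (\<Union>i\<in>C. cball (c i) (r i)))"
    using Vitali_covering_theorem_cballs[of K r E c] by blast
  define \<mu> where "\<mu> = measure (lebesgue :: real measure)"
  define I where "I p = {fst p..snd p}" for p :: "real \<times> real"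
  have disj: "disjoint_family_on I C"
    using C(3) unfolding disjoint_family_on_def pairwise_def disjnt_def ball I_def by blast
  have neg: "negligible (E - (\<Union>i\<in>C. I i))"
    using C(4) unfolding ball I_def .
  have I_meas: "I p \<in> lmeasurable" for p
    by (simp add: I_def)
  have I_sub: "I p \<subseteq> U" "fst p < snd p" "Q (fst p) (snd p)" if "p \<in> C" for p
    using that C(2) by (auto simp: K_def I_def)
  have sum_eq: "(\<Sum>p\<in>F. \<mu> (I p)) = \<mu> (\<Union>p\<in>F. I p)" if "finite F" "F \<subseteq> C" for F
    unfolding \<mu>_def using that
    by (intro measure_finite_Union[symmetric])
       (auto simp: I_def emeasure_lborel_Icc_eq intro: disjoint_family_on_mono[OF _ disj, unfolded I_def])
  \<comment> \<open>The lengths of the intervals in \<open>C\<close> have bounded finite sums; a finite \<open>D\<close> whose sum is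
    almost maximal leaves a tail of small measure.\<close>
  define L where "L = (\<lambda>F. \<Sum>p\<in>F. \<mu> (I p)) ` {F. finite F \<and> F \<subseteq> C}"
  have L_bdd: "bdd_above L"
  proof (rule bdd_aboveI)
    fix l assume "l \<in> L"
    then obtain F where F: "finite F" "F \<subseteq> C" "l = (\<Sum>p\<in>F. \<mu> (I p))"
      by (auto simp: L_def)
    then have "l = \<mu> (\<Union>p\<in>F. I p)" using sum_eq by simp
    also have "\<dots> \<le> \<mu> U"
      unfolding \<mu>_def using F I_sub I_meas assms(2)
      by (intro measure_mono_fmeasurable) (auto intro!: sets.finite_UN fmeasurableD)
    finally show "l \<le> \<mu> U" .
  qed
  have "L \<noteq> {}" by (auto simp: L_def)
  then have "\<exists>l\<in>L. Sup L - \<epsilon>/2 < l"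
    using less_cSup_iff[OF _ L_bdd, of "Sup L - \<epsilon>/2"] \<open>\<epsilon> > 0\<close> by auto
  then obtain D where D: "finite D" "D \<subseteq> C" "Sup L - \<epsilon>/2 < (\<Sum>p\<in>D. \<mu> (I p))"
    by (auto simp: L_def)
  have tail_bound: "measure lebesgue (\<Union>p\<in>F. I p) \<le> \<epsilon>/2" if "F \<subseteq> C - D" "finite F" for F
  proof -
    have "(\<Sum>p\<in>D \<union> F. \<mu> (I p)) \<in> L"
      using that D by (auto simp: L_def)
    then have "(\<Sum>p\<in>D \<union> F. \<mu> (I p)) \<le> Sup L"
      using L_bdd by (rule cSup_upper)
    moreover have "(\<Sum>p\<in>D \<union> F. \<mu> (I p)) = (\<Sum>p\<in>D. \<mu> (I p)) + (\<Sum>p\<in>F. \<mu> (I p))"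
      using that D by (intro sum.union_disjoint) auto
    ultimately have "(\<Sum>p\<in>F. \<mu> (I p)) \<le> \<epsilon>/2"
      using D(3) by linarith
    then show ?thesis
      using sum_eq[of F] that unfolding \<mu>_def by (metis Diff_subset order_trans)
  qed
  define R where "R = (\<Union>p\<in>C - D. I p)"
  have R: "R \<in> lmeasurable" "\<mu> R \<le> \<epsilon>/2"
    unfolding R_def \<mu>_def
    by (rule fmeasurable_UN_bound[OF _ I_meas tail_bound] measure_UN_bound[OF _ I_meas tail_bound];
        use C(1) in auto)+
  define Z where "Z = (E - (\<Union>i\<in>C. I i)) \<union> (fst ` D \<union> snd ` D)"
  have "negligible Z"
    unfolding Z_def using neg D(1) by (auto intro: negligible_finite)
  then have Z: "Z \<in> lmeasurable" "\<mu> Z = 0"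
    by (auto simp: negligible_iff_measure \<mu>_def)
  show ?thesis
  proof (rule that[of D "R \<union> Z"])
    show "finite D" by fact
    show "u < v \<and> {u..v} \<subseteq> U \<and> Q u v" if "(u, v) \<in> D" for u v
      using that D(2) I_sub[of "(u, v)"] by (auto simp: I_def)
    show "disjoint_family_on (\<lambda>p. {fst p..snd p}) D"
      using disjoint_family_on_mono[OF D(2) disj] by (simp add: I_def[abs_def])
    show "R \<union> Z \<in> lmeasurable"
      using R Z by (intro fmeasurable.Un)
    have "\<mu> (R \<union> Z) \<le> \<mu> R + \<mu> Z"
      unfolding \<mu>_def using R Z by (intro measure_Un_le) (auto simp: fmeasurableD)
    then show "measure lebesgue (R \<union> Z) < \<epsilon>"
      using R Z \<open>\<epsilon> > 0\<close> by (simp add: \<mu>_def)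
    show "E \<subseteq> (\<Union>p\<in>D. {fst p<..<snd p}) \<union> (R \<union> Z)"
    proof
      fix x assume "x \<in> E"
      show "x \<in> (\<Union>p\<in>D. {fst p<..<snd p}) \<union> (R \<union> Z)"
      proof (cases "x \<in> (\<Union>i\<in>C. I i)")
        case True
        then obtain p where p: "p \<in> C" "x \<in> I p" by auto
        show ?thesis
        proof (cases "p \<in> D")
          case True
          have "x = fst p \<or> x = snd p \<or> x \<in> {fst p<..<snd p}"
            using p(2) by (auto simp: I_def)
          then show ?thesis
            using True unfolding Z_def by blast
        qed (use p in \<open>auto simp: R_def\<close>)
      qed (use \<open>x \<in> E\<close> in \<open>auto simp: Z_def\<close>)
    qed
  qed
qed

text \<open>For monotone \<open>F\<close>, increments over disjoint intervals are lengths of disjoint image intervals. This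
reduces comparisons of sums of increments to comparisons of measures.\<close>

lemma mono_disjoint_image_intervals:
  fixes F :: "real \<Rightarrow> real"
  assumes "mono F" and disj: "disjoint_family_on (\<lambda>p. {fst p..snd p}) D"
    and lt: "\<And>p. p \<in> D \<Longrightarrow> fst p < snd p"
  shows "disjoint_family_on (\<lambda>p. {F (fst p)<..<F (snd p)}) D"
  unfolding disjoint_family_on_def
proof (intro ballI impI)
  fix p q assume pq: "p \<in> D" "q \<in> D" "p \<noteq> q"
  then have "{fst p..snd p} \<inter> {fst q..snd q} = {}"
    using disj by (auto simp: disjoint_family_on_def)
  then have "snd p < fst q \<or> snd q < fst p"
    using lt[OF pq(1)] lt[OF pq(2)] by (auto simp: Int_atLeastAtMost max_def min_def split: if_splits)
  then show "{F (fst p)<..<F (snd p)} \<inter> {F (fst q)<..<F (snd q)} = {}"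
    using monoD[OF \<open>mono F\<close>, of "snd p" "fst q"] monoD[OF \<open>mono F\<close>, of "snd q" "fst p"] by auto
qed

text \<open>Disjoint intervals of slope above \<open>q\<close> in \<open>(a, b)\<close> have total length at most \<open>(F b - F a) / q\<close>.\<close>

lemma mono_negligible_infinite_slope:
  fixes F :: "real \<Rightarrow> real"
  assumes "mono F"
  shows "negligible {x \<in> {a<..<b}. \<forall>q>0. finely_covered (\<lambda>u v. q * (v - u) < F v - F u) x}"
    (is "negligible ?E")
proof (cases "a < b")
  case True
  show ?thesis
    unfolding negligible_outer
  proof (intro allI impI)
    fix e :: real assume "e > 0"
    \<comment> \<open>The summand \<open>1\<close> keeps \<open>q\<close> positive when \<open>F\<close> is constant on \<open>[a, b]\<close>.\<close>
    define q where "q = (F b - F a + 1) * 2 / e"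
    have Fab: "F a \<le> F b" using \<open>mono F\<close> True by (simp add: monoD)
    then have "q > 0" using \<open>e > 0\<close> by (simp add: q_def)
    obtain D W where D: "finite D"
      "\<And>u v. (u, v) \<in> D \<Longrightarrow> u < v \<and> {u..v} \<subseteq> {a<..<b} \<and> q * (v - u) < F v - F u"
      "disjoint_family_on (\<lambda>p. {fst p..snd p}) D"
      and W: "W \<in> lmeasurable" "measure lebesgue W < e/2"
      and cover: "?E \<subseteq> (\<Union>p\<in>D. {fst p<..<snd p}) \<union> W"
      by (rule finite_Vitali_covering_intervals[of "{a<..<b}" ?E "\<lambda>u v. q * (v - u) < F v - F u" "e/2"])
         (use \<open>q > 0\<close> \<open>e > 0\<close> in auto)
    have lt: "fst p < snd p" "a < fst p" "snd p < b" "q * (snd p - fst p) < F (snd p) - F (fst p)"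
      if "p \<in> D" for p
      using D(2)[of "fst p" "snd p"] that by (force simp: subset_iff)+
    let ?V = "\<Union>p\<in>D. {fst p<..<snd p}"
    have V: "?V \<in> lmeasurable"
      using D(1) by (intro fmeasurable.finite_UN) auto
    have "measure lebesgue ?V \<le> (\<Sum>p\<in>D. measure lebesgue {fst p<..<snd p})"
      using D(1) by (intro measure_UNION_le) auto
    also have "\<dots> = (\<Sum>p\<in>D. snd p - fst p)"
      by (intro sum.cong) (auto dest: lt(1) simp: less_imp_le)
    finally have "q * measure lebesgue ?V \<le> q * (\<Sum>p\<in>D. snd p - fst p)"
      using \<open>q > 0\<close> by simp
    also have "\<dots> = (\<Sum>p\<in>D. q * (snd p - fst p))"
      by (rule sum_distrib_left)
    also have "\<dots> \<le> (\<Sum>p\<in>D. F (snd p) - F (fst p))"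
      by (intro sum_mono less_imp_le lt(4))
    also have "\<dots> \<le> measure lebesgue {F a<..<F b}"
    proof (rule sum_lengths_le_measure)
      show "disjoint_family_on (\<lambda>p. {F (fst p)<..<F (snd p)}) D"
        using \<open>mono F\<close> D(3) lt(1) by (rule mono_disjoint_image_intervals)
      fix p assume p: "p \<in> D"
      show "F (fst p) \<le> F (snd p)"
        using lt[OF p] \<open>mono F\<close> by (simp add: monoD)
      have "F a \<le> F (fst p)" "F (snd p) \<le> F b"
        using lt[OF p] \<open>mono F\<close> by (simp_all add: monoD)
      then show "{F (fst p)<..<F (snd p)} \<subseteq> {F a<..<F b}"
        by auto
    qed (use D(1) in auto)
    also have "\<dots> = F b - F a" using Fab by simp
    finally have "measure lebesgue ?V \<le> (F b - F a) / q"
      using \<open>q > 0\<close> by (simp add: field_simps)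
    also have "\<dots> < e / 2"
      using \<open>e > 0\<close> Fab by (simp add: q_def field_simps)
    finally have "measure lebesgue (?V \<union> W) < e"
      using measure_Un_le[of ?V lebesgue W] V W by (auto simp: fmeasurableD)
    moreover have "?V \<union> W \<in> lmeasurable"
      using V W by (intro fmeasurable.Un)
    ultimately show "\<exists>T. ?E \<subseteq> T \<and> T \<in> lmeasurable \<and> measure lebesgue T < e"
      using cover by blast
  qed
qed auto

text \<open>The heart of Lebesgue's differentiation theorem. Let \<open>m\<close> be the outer measure of the set and cover
it by an open \<open>U\<close> of measure close to \<open>m\<close>. Flat intervals \<open>D1\<close> inside \<open>U\<close> almost cover the set,
and steep intervals \<open>D2\<close> inside those again almost cover it. As \<open>D2\<close> lies in \<open>D1\<close>, monotonicity bounds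
the increments over \<open>D2\<close> by those over \<open>D1\<close>, so \<open>q m\<close> is at most about \<open>p m\<close>; hence \<open>m = 0\<close>.\<close>

lemma mono_negligible_oscillating_slope:
  fixes F :: "real \<Rightarrow> real"
  assumes "mono F" and "0 \<le> p" "p < q"
  shows "negligible {x \<in> {a<..<b}. finely_covered (\<lambda>u v. F v - F u < p * (v - u)) x \<and>
                                  finely_covered (\<lambda>u v. q * (v - u) < F v - F u) x}"
    (is "negligible ?E")
proof -
  define \<mu> where "\<mu> = measure (lebesgue :: real measure)"
  define M where "M = {\<mu> S | S. S \<in> lmeasurable \<and> ?E \<subseteq> S}"
  define m where "m = Inf M"
  have M_ne: "M \<noteq> {}"
  proof -
    have "?E \<subseteq> {a<..<b}" by auto
    then show ?thesis unfolding M_def using lmeasurable_interval by blast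
  qed
  have M_bdd: "bdd_below M"
    by (rule bdd_belowI[of _ 0]) (auto simp: M_def \<mu>_def)
  have m_le: "m \<le> \<mu> S" if "S \<in> lmeasurable" "?E \<subseteq> S" for S
    unfolding m_def using that by (intro cInf_lower M_bdd) (auto simp: M_def)
  have m_less: "\<exists>S. S \<in> lmeasurable \<and> ?E \<subseteq> S \<and> \<mu> S < m + e" if "e > 0" for e
    using cInf_lessD[OF M_ne, of "m + e"] that by (auto simp: m_def M_def)
  have "m \<ge> 0"
    unfolding m_def by (rule cInf_greatest[OF M_ne]) (auto simp: M_def \<mu>_def)
  have "m \<le> 0"
  proof (rule ccontr)
    assume "\<not> m \<le> 0"
    then have "m > 0" by simp
    \<comment> \<open>Half the value at which the inequality \<open>p (m + 2 \<epsilon>) < q (m - 2 \<epsilon>)\<close> turns into an equality.\<close>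
    define \<epsilon> where "\<epsilon> = (q - p) * m / (4 * (p + q))"
    have "p + q > 0" using assms by simp
    then have "\<epsilon> > 0"
      using \<open>m > 0\<close> assms by (simp add: \<epsilon>_def)
    have \<epsilon>: "p * (m + 2 * \<epsilon>) < q * (m - 2 * \<epsilon>)"
    proof -
      have "4 * (p + q) * \<epsilon> = (q - p) * m"
        using \<open>p + q > 0\<close> by (simp add: \<epsilon>_def)
      moreover have "0 < (p + q) * \<epsilon>"
        using \<open>p + q > 0\<close> \<open>\<epsilon> > 0\<close> by simp
      ultimately show ?thesis by (simp add: algebra_simps)
    qed
    obtain S where S: "S \<in> lmeasurable" "?E \<subseteq> S" "\<mu> S < m + \<epsilon>"
      using m_less[OF \<open>\<epsilon> > 0\<close>] by blast
    obtain U where U: "open U" "S \<subseteq> U" "U \<in> lmeasurable" "\<mu> U < \<mu> S + \<epsilon>"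
      using lmeasurable_outer_open[OF S(1) \<open>\<epsilon> > 0\<close>] unfolding \<mu>_def by blast
    obtain D1 W1 where D1: "finite D1"
      "\<And>u v. (u, v) \<in> D1 \<Longrightarrow> u < v \<and> {u..v} \<subseteq> U \<and> F v - F u < p * (v - u)"
      "disjoint_family_on (\<lambda>p. {fst p..snd p}) D1"
      and W1: "W1 \<in> lmeasurable" "measure lebesgue W1 < \<epsilon>"
      and cover1: "?E \<subseteq> (\<Union>p\<in>D1. {fst p<..<snd p}) \<union> W1"
      by (rule finite_Vitali_covering_intervals[of U ?E "\<lambda>u v. F v - F u < p * (v - u)" \<epsilon>])
         (use U S \<open>\<epsilon> > 0\<close> in auto)
    have lt1: "fst i < snd i" "{fst i..snd i} \<subseteq> U" "F (snd i) - F (fst i) < p * (snd i - fst i)"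
      if "i \<in> D1" for i
      using D1(2)[of "fst i" "snd i"] that by auto
    define V1 where "V1 = (\<Union>p\<in>D1. {fst p<..<snd p})"
    have "open V1" by (auto simp: V1_def)
    have "V1 \<in> lmeasurable"
      unfolding V1_def using D1(1) by (intro fmeasurable.finite_UN) auto
    \<comment> \<open>Steep intervals inside the flat ones already chosen.\<close>
    let ?Q = "\<lambda>u v. q * (v - u) < F v - F u \<and> (\<exists>i\<in>D1. {u..v} \<subseteq> {fst i<..<snd i})"
    have fine2: "finely_covered ?Q x" if x: "x \<in> ?E \<inter> V1" for x
      unfolding finely_covered_def
    proof (intro allI impI)
      fix d :: real assume "d > 0"
      obtain i where i: "i \<in> D1" "fst i < x" "x < snd i"
        using x by (auto simp: V1_def)
      then have "min d (min (x - fst i) (snd i - x)) > 0"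
        using \<open>d > 0\<close> by simp
      then obtain u v where uv: "u < v" "v - u < min d (min (x - fst i) (snd i - x))"
          "u \<le> x" "x \<le> v" "q * (v - u) < F v - F u"
        using x unfolding finely_covered_def by blast
      moreover from uv have "{u..v} \<subseteq> {fst i<..<snd i}"
        by auto
      ultimately show "\<exists>u v. u < v \<and> v - u < d \<and> u \<le> x \<and> x \<le> v \<and> ?Q u v"
        using i(1) by (metis min_less_iff_conj)
    qed
    obtain D2 W2 where D2: "finite D2"
      "\<And>u v. (u, v) \<in> D2 \<Longrightarrow> u < v \<and> {u..v} \<subseteq> V1 \<and> ?Q u v"
      "disjoint_family_on (\<lambda>p. {fst p..snd p}) D2"
      and W2: "W2 \<in> lmeasurable" "measure lebesgue W2 < \<epsilon>"
      and cover2: "?E \<inter> V1 \<subseteq> (\<Union>p\<in>D2. {fst p<..<snd p}) \<union> W2"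
      by (rule finite_Vitali_covering_intervals[of V1 "?E \<inter> V1" ?Q \<epsilon>])
         (use \<open>open V1\<close> \<open>V1 \<in> lmeasurable\<close> fine2 \<open>\<epsilon> > 0\<close> in auto)
    have lt2: "fst j < snd j" "q * (snd j - fst j) < F (snd j) - F (fst j)"
      "\<exists>i\<in>D1. {fst j..snd j} \<subseteq> {fst i<..<snd i}" if "j \<in> D2" for j
      using D2(2)[of "fst j" "snd j"] that by auto
    define V2 where "V2 = (\<Union>p\<in>D2. {fst p<..<snd p})"
    have V2: "V2 \<in> lmeasurable"
      unfolding V2_def using D2(1) by (intro fmeasurable.finite_UN) auto
    have "m \<le> \<mu> (V2 \<union> (W1 \<union> W2))"
    proof (rule m_le)
      show "V2 \<union> (W1 \<union> W2) \<in> lmeasurable"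
        using V2 W1 W2 by (intro fmeasurable.Un)
      show "?E \<subseteq> V2 \<union> (W1 \<union> W2)"
        using cover1 cover2 unfolding V1_def V2_def by blast
    qed
    also have "\<dots> \<le> \<mu> V2 + (\<mu> W1 + \<mu> W2)"
      unfolding \<mu>_def
      by (intro order_trans[OF measure_Un_le] add_left_mono measure_Un_le)
         (use V2 W1 W2 in \<open>auto simp: fmeasurableD\<close>)
    also have "\<dots> < \<mu> V2 + 2 * \<epsilon>"
      using W1 W2 by (simp add: \<mu>_def)
    also have "\<mu> V2 \<le> (\<Sum>j\<in>D2. \<mu> {fst j<..<snd j})"
      unfolding \<mu>_def V2_def using D2(1) by (intro measure_UNION_le) auto
    also have "\<dots> = (\<Sum>j\<in>D2. snd j - fst j)"
      by (intro sum.cong) (auto dest: lt2(1) simp: less_imp_le \<mu>_def)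
    finally have "q * (m - 2 * \<epsilon>) \<le> q * (\<Sum>j\<in>D2. snd j - fst j)"
      using assms by (intro mult_left_mono) auto
    also have "\<dots> = (\<Sum>j\<in>D2. q * (snd j - fst j))"
      by (rule sum_distrib_left)
    also have "\<dots> \<le> (\<Sum>j\<in>D2. F (snd j) - F (fst j))"
      by (intro sum_mono less_imp_le lt2(2))
    also have "\<dots> \<le> \<mu> (\<Union>i\<in>D1. {F (fst i)<..<F (snd i)})"
      unfolding \<mu>_def
    proof (rule sum_lengths_le_measure)
      show "disjoint_family_on (\<lambda>p. {F (fst p)<..<F (snd p)}) D2"
        using \<open>mono F\<close> D2(3) lt2(1) by (rule mono_disjoint_image_intervals)
      show "(\<Union>i\<in>D1. {F (fst i)<..<F (snd i)}) \<in> lmeasurable"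
        using D1(1) by (intro fmeasurable.finite_UN) auto
      fix j assume j: "j \<in> D2"
      show "F (fst j) \<le> F (snd j)"
        using lt2[OF j] \<open>mono F\<close> by (simp add: monoD)
      obtain i where i: "i \<in> D1" "{fst j..snd j} \<subseteq> {fst i<..<snd i}"
        using lt2(3)[OF j] by blast
      then have "fst i < fst j" "snd j < snd i"
        using lt2(1)[OF j] by (auto simp: subset_iff)
      then have "F (fst i) \<le> F (fst j)" "F (snd j) \<le> F (snd i)"
        using \<open>mono F\<close> by (simp_all add: monoD)
      then have "{F (fst j)<..<F (snd j)} \<subseteq> {F (fst i)<..<F (snd i)}"
        by auto
      then show "{F (fst j)<..<F (snd j)} \<subseteq> (\<Union>i\<in>D1. {F (fst i)<..<F (snd i)})"
        using i(1) by blast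
    qed (use D2(1) in auto)
    also have "\<dots> \<le> (\<Sum>i\<in>D1. \<mu> {F (fst i)<..<F (snd i)})"
      unfolding \<mu>_def using D1(1) by (intro measure_UNION_le) auto
    also have "\<dots> = (\<Sum>i\<in>D1. F (snd i) - F (fst i))"
      using \<open>mono F\<close> by (intro sum.cong) (auto dest!: lt1(1) simp: \<mu>_def monoD less_imp_le)
    also have "\<dots> \<le> (\<Sum>i\<in>D1. p * (snd i - fst i))"
      by (intro sum_mono less_imp_le lt1(3))
    also have "\<dots> = p * (\<Sum>i\<in>D1. snd i - fst i)"
      by (rule sum_distrib_left[symmetric])
    also have "\<dots> \<le> p * \<mu> U"
    proof (intro mult_left_mono \<open>0 \<le> p\<close>)
      show "(\<Sum>i\<in>D1. snd i - fst i) \<le> \<mu> U"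
        unfolding \<mu>_def
      proof (rule sum_lengths_le_measure)
        show "disjoint_family_on (\<lambda>i. {fst i<..<snd i}) D1"
        proof -
          have "{fst i<..<snd i} \<subseteq> {fst i..snd i}" for i :: "real \<times> real" by auto
          then show ?thesis
            using D1(3) unfolding disjoint_family_on_def by blast
        qed
        show "{fst i<..<snd i} \<subseteq> U" if "i \<in> D1" for i
          using lt1(2)[OF that] by (meson greaterThanLessThan_subseteq_atLeastAtMost_iff order_refl order_trans)
      qed (use D1(1) U(3) lt1(1) in \<open>auto simp: less_imp_le\<close>)
    qed
    also have "\<dots> \<le> p * (m + 2 * \<epsilon>)"
      using U(4) S(3) \<open>0 \<le> p\<close> by (intro mult_left_mono) auto
    finally show False using \<epsilon> by simp
  qed
  then show ?thesis
    unfolding negligible_outer using m_less \<open>m \<ge> 0\<close> by (auto simp: \<mu>_def)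
qed

text \<open>Off the countably many null sets of the two preceding lemmas, the difference quotients at \<open>x\<close> are
bounded and cannot oscillate across any pair of rationals, so they converge.\<close>

lemma mono_ae_differentiable:
  fixes F :: "real \<Rightarrow> real"
  assumes "mono F"
  shows "negligible {x. \<not> F differentiable (at x)}"
proof -
  define Inf_slope where "Inf_slope n =
      {x \<in> {-real n<..<real n}. \<forall>q>0. finely_covered (\<lambda>u v. q * (v - u) < F v - F u) x}" for n
  define Osc where "Osc n p q =
      {x \<in> {-real n<..<real n}. finely_covered (\<lambda>u v. F v - F u < p * (v - u)) x \<and>
                               finely_covered (\<lambda>u v. q * (v - u) < F v - F u) x}" for n p q
  define R where "R = {(p, q). p \<in> \<rat> \<and> q \<in> \<rat> \<and> 0 \<le> p \<and> p < (q::real)}"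
  have "countable R"
    by (rule countable_subset[of _ "\<rat> \<times> \<rat>"]) (auto simp: R_def countable_rat)
  define N where "N = (\<Union>n. Inf_slope n) \<union> (\<Union>n. \<Union>(p, q)\<in>R. Osc n p q)"
  have "negligible (\<Union>n. Inf_slope n)"
    unfolding Inf_slope_def
    by (intro negligible_countable_Union; use mono_negligible_infinite_slope[OF assms] in blast)
  moreover have "negligible (\<Union>n. \<Union>(p, q)\<in>R. Osc n p q)"
  proof -
    have "negligible (Osc n p q)" if "(p, q) \<in> R" for n p q
      unfolding Osc_def
      by (rule mono_negligible_oscillating_slope[OF assms]) (use that in \<open>auto simp: R_def\<close>)
    then have "negligible (\<Union>(p, q)\<in>R. Osc n p q)" for n
      using \<open>countable R\<close> by (intro negligible_countable_Union) auto
    then show ?thesis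
      by (intro negligible_countable_Union) auto
  qed
  ultimately have "negligible N"
    unfolding N_def by (rule negligible_Un)
  moreover have "F differentiable (at x)" if "x \<notin> N" for x
  proof -
    define \<phi> where "\<phi> y = (F y - F x) / (y - x)" for y
    \<comment> \<open>Difference quotients at \<open>x\<close> are slopes over intervals having \<open>x\<close> as an endpoint.\<close>
    have slope: "\<forall>\<^sub>F y in at x. \<not> Q (\<phi> y)"
      if not_fine: "\<not> finely_covered (\<lambda>u v. Q ((F v - F u) / (v - u))) x" for Q
    proof -
      obtain d where d: "d > 0"
        "\<And>u v. u < v \<Longrightarrow> v - u < d \<Longrightarrow> u \<le> x \<Longrightarrow> x \<le> v \<Longrightarrow> \<not> Q ((F v - F u) / (v - u))"
        using not_fine unfolding finely_covered_def by blast
      have "\<not> Q (\<phi> y)" if "y \<noteq> x" "dist y x < d" for y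
      proof (cases "y < x")
        case True
        have "\<phi> y = (F x - F y) / (x - y)"
          unfolding \<phi>_def by (metis minus_diff_eq minus_divide_divide)
        then show ?thesis
          using d(2)[of y x] True that by (simp add: dist_real_def)
      next
        case False
        then show ?thesis
          using d(2)[of x y] that by (simp add: dist_real_def \<phi>_def)
      qed
      then show ?thesis
        unfolding eventually_at using \<open>d > 0\<close> by blast
    qed
    have fc_cong: "finely_covered Q x \<longleftrightarrow> finely_covered Q' x"
      if "\<And>u v. u < v \<Longrightarrow> Q u v \<longleftrightarrow> Q' u v" for Q Q'
      unfolding finely_covered_def using that by meson
    have lower: "finely_covered (\<lambda>u v. F v - F u < p * (v - u)) x \<longleftrightarrow>
        finely_covered (\<lambda>u v. (F v - F u) / (v - u) < p) x" for p
      by (rule fc_cong) (simp add: field_simps)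
    have upper: "finely_covered (\<lambda>u v. q * (v - u) < F v - F u) x \<longleftrightarrow>
        finely_covered (\<lambda>u v. q < (F v - F u) / (v - u)) x" for q
      by (rule fc_cong) (simp add: field_simps)
    obtain n :: nat where "\<bar>x\<bar> < real n"
      using reals_Archimedean2 by blast
    then have n: "x \<in> {-real n<..<real n}"
      by auto
    have "x \<notin> Inf_slope n" using that by (auto simp: N_def)
    then obtain q0 where "\<not> finely_covered (\<lambda>u v. q0 * (v - u) < F v - F u) x"
      using n by (auto simp: Inf_slope_def)
    then have q0: "\<forall>\<^sub>F y in at x. \<phi> y \<le> q0"
      using slope[of "\<lambda>z. q0 < z"] by (simp add: upper not_less)
    have dichotomy: "(\<forall>\<^sub>F y in at x. p \<le> \<phi> y) \<or> (\<forall>\<^sub>F y in at x. \<phi> y \<le> q)"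
      if "(p, q) \<in> R" for p q
    proof -
      have "x \<notin> Osc n p q"
        using \<open>x \<notin> N\<close> that by (auto simp: N_def)
      then show ?thesis
        using n slope[of "\<lambda>z. z < p"] slope[of "\<lambda>z. q < z"]
        by (auto simp: Osc_def lower upper not_less)
    qed
    have nonneg: "0 \<le> \<phi> y" for y
      using monoD[OF assms, of x y] monoD[OF assms, of y x]
      by (cases "x \<le> y") (auto simp: \<phi>_def zero_le_divide_iff)
    define A where "A = {p. \<forall>\<^sub>F y in at x. p \<le> \<phi> y}"
    define l where "l = Sup A"
    have "0 \<in> A" using nonneg by (simp add: A_def)
    have A_le: "p \<le> q" if "p \<in> A" "\<forall>\<^sub>F y in at x. \<phi> y \<le> q" for p q
    proof -
      have "\<forall>\<^sub>F y in at x. p \<le> q"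
        using that(1)[unfolded A_def mem_Collect_eq] that(2) by eventually_elim simp
      then show ?thesis by simp
    qed
    have bdd: "bdd_above A"
      using A_le[OF _ q0] by (rule bdd_aboveI)
    have "0 \<le> l"
      unfolding l_def using \<open>0 \<in> A\<close> bdd by (rule cSup_upper)
    have "(\<phi> \<longlongrightarrow> l) (at x)"
    proof (rule order_tendstoI)
      fix c assume "c < l"
      then obtain p where "p \<in> A" "c < p"
        using less_cSup_iff[OF _ bdd, of c] \<open>0 \<in> A\<close> by (auto simp: l_def)
      then have "\<forall>\<^sub>F y in at x. p \<le> \<phi> y" by (simp add: A_def)
      then show "\<forall>\<^sub>F y in at x. c < \<phi> y"
        by eventually_elim (use \<open>c < p\<close> in simp)
    next
      fix c assume "l < c"
      obtain p where p: "p \<in> \<rat>" "l < p" "p < c"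
        using Rats_dense_in_real[OF \<open>l < c\<close>] by blast
      obtain q where q: "q \<in> \<rat>" "p < q" "q < c"
        using Rats_dense_in_real[OF \<open>p < c\<close>] by blast
      have "p \<notin> A"
        using cSup_upper[OF _ bdd, of p] p(2) by (auto simp: l_def)
      moreover have "(p, q) \<in> R"
        using p q \<open>0 \<le> l\<close> by (simp add: R_def)
      ultimately have "\<forall>\<^sub>F y in at x. \<phi> y \<le> q"
        using dichotomy by (auto simp: A_def)
      then show "\<forall>\<^sub>F y in at x. \<phi> y < c"
        by eventually_elim (use \<open>q < c\<close> in simp)
    qed
    then have "(F has_real_derivative l) (at x)"
      unfolding has_field_derivative_iff \<phi>_def .
    then show ?thesis
      using real_differentiable_def by blast
  qed
  ultimately show ?thesis
    by (rule_tac negligible_subset[of N]) auto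
qed

text \<open>The monotone parts \<open>P\<close> and \<open>P - f\<close> are extended to the whole line by constants; this changes
differentiability at most at \<open>a\<close> and \<open>b\<close>.\<close>

lemma abs_continuous_ae_differentiable:
  fixes f :: "real \<Rightarrow> real"
  assumes "abs_continuous_on_interval a b f" and "a \<le> b"
  shows "negligible {x \<in> {a..b}. \<not> f differentiable (at x)}"
proof -
  obtain P where P: "mono_on {a..b} P" "mono_on {a..b} (\<lambda>x. P x - f x)"
    using abs_continuous_Jordan_decomposition[OF assms] .
  define ext where "ext g x = g (max a (min b x))" for g :: "real \<Rightarrow> real" and x
  have ext_mono: "mono (ext g)" if "mono_on {a..b} g" for g
    unfolding ext_def
    by (intro monoI mono_onD[OF that]) (use \<open>a \<le> b\<close> in auto)
  let ?N = "{x. \<not> ext P differentiable (at x)} \<union>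
      {x. \<not> ext (\<lambda>x. P x - f x) differentiable (at x)} \<union> {a, b}"
  have "negligible ?N"
    using mono_ae_differentiable[OF ext_mono[OF P(1)]] mono_ae_differentiable[OF ext_mono[OF P(2)]]
    by (simp add: negligible_finite)
  moreover have "f differentiable (at x)" if "x \<in> {a..b}" "x \<notin> ?N" for x
  proof -
    have "(\<lambda>y. ext P y - ext (\<lambda>x. P x - f x) y) differentiable (at x)"
      using that by (intro differentiable_diff) auto
    then obtain D where "((\<lambda>y. ext P y - ext (\<lambda>x. P x - f x) y) has_derivative D) (at x)"
      unfolding differentiable_def by blast
    moreover have "open {a<..<b}" "x \<in> {a<..<b}"
      using that by auto
    ultimately have "(f has_derivative D) (at x)"
      by (rule has_derivative_transform_within_open) (auto simp: ext_def)
    then show ?thesis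
      unfolding differentiable_def by blast
  qed
  ultimately show ?thesis
    by (rule_tac negligible_subset[of ?N]) auto
qed

section \<open>The fundamental theorem of calculus for absolutely continuous functions\<close>

text \<open>The gauge at a point outside \<open>S\<close> makes the increment of \<open>f\<close> agree with the linear approximation up to
\<open>e/2\<close> times the length. At a point of \<open>S\<close> the gauge is an open superset \<open>U\<close> of \<open>S\<close> with measure below
the \<open>\<delta>\<close> of absolute continuity: the intervals tagged in \<open>S\<close> then contribute nothing to the Riemann
sum, as \<open>f'\<close> vanishes there, and their increments of \<open>f\<close> add up to little.\<close>

lemma abs_continuous_has_integral_ae_deriv:
  fixes f :: "real \<Rightarrow> real"
  assumes ac: "abs_continuous_on_interval a b f" and "a \<le> b" and "negligible S"
    and deriv: "\<And>x. x \<in> {a..b} - S \<Longrightarrow> (f has_real_derivative f' x) (at x within {a..b})"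
    and zero: "\<And>x. x \<in> S \<Longrightarrow> f' x = 0"
  shows "(f' has_integral (f b - f a)) {a..b}"
proof (cases "a < b")
  case True
  show ?thesis
    unfolding has_integral_factor_content_real
  proof (intro allI impI)
    fix e :: real
    assume "e > 0"
    then have e2: "e/2 > 0" and e3: "e/2 * (b - a) > 0"
      using True by auto
    have "\<forall>x. \<exists>d>0. x \<in> {a..b} - S \<longrightarrow>
        (\<forall>y\<in>{a..b}. norm (y - x) < d \<longrightarrow> norm (f y - f x - f' x * (y - x)) \<le> e/2 * norm (y - x))"
      using deriv[unfolded has_field_derivative_def has_derivative_within_alt] e2 by (meson zero_less_one)
    then obtain d where d: "\<And>x. 0 < d x"
      "\<And>x y. \<lbrakk>x \<in> {a..b} - S; y \<in> {a..b}; \<bar>y - x\<bar> < d x\<rbrakk>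
              \<Longrightarrow> \<bar>f y - f x - f' x * (y - x)\<bar> \<le> e/2 * \<bar>y - x\<bar>"
      unfolding real_norm_def by metis
    obtain \<delta> where "\<delta> > 0" and \<delta>: "\<And>(I :: (real \<times> real set) set) u v.
      \<lbrakk>finite I; \<And>i. i \<in> I \<Longrightarrow> a \<le> u i \<and> u i \<le> v i \<and> v i \<le> b;
       disjoint_family_on (\<lambda>i. {u i<..<v i}) I; (\<Sum>i\<in>I. v i - u i) < \<delta>\<rbrakk>
      \<Longrightarrow> (\<Sum>i\<in>I. \<bar>f (v i) - f (u i)\<bar>) < e/2 * (b - a)"
      using abs_continuous_finite_family[OF ac e3] by blast
    have "S \<in> lmeasurable" "measure lebesgue S = 0"
      using \<open>negligible S\<close> by (auto simp: negligible_iff_measure)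
    then obtain U where U: "open U" "S \<subseteq> U" "U \<in> lmeasurable" "measure lebesgue U < \<delta>"
      using lmeasurable_outer_open[of S \<delta>] \<open>\<delta> > 0\<close> by auto
    define \<gamma> where "\<gamma> x = (if x \<in> S then U else ball x (d x))" for x
    have gauge: "gauge \<gamma>"
      using U d(1) by (auto simp: gauge_def \<gamma>_def)
    have bound: "norm ((\<Sum>(x,k)\<in>p. measure lborel k *\<^sub>R f' x) - (f b - f a)) \<le> e * measure lborel {a..b}"
      if ptag: "p tagged_division_of {a..b}" and fine: "\<gamma> fine p" for p
    proof -
      note p = tagged_division_ofD[OF ptag]
      define u v where "u i = Inf (snd i)" and "v i = Sup (snd i)" for i :: "real \<times> real set"
      have K: "snd i = {u i..v i} \<and> a \<le> u i \<and> u i \<le> fst i \<and> fst i \<le> v i \<and> v i \<le> b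
          \<and> {u i..v i} \<subseteq> \<gamma> (fst i)" if ip: "i \<in> p" for i
      proof -
        obtain x K where i: "i = (x, K)" by (cases i)
        obtain s t where st: "K = {s..t}"
          using p(4)[of x K] ip i by (auto simp: cbox_interval)
        have "x \<in> K" "K \<subseteq> {a..b}" "K \<subseteq> \<gamma> x"
          using p(2,3)[of x K] ip fine i by (auto simp: fine_def)
        then show ?thesis
          unfolding u_def v_def i st by auto
      qed
      have disj: "disjoint_family_on (\<lambda>i. {u i<..<v i}) p"
        unfolding disjoint_family_on_def
      proof (intro ballI impI)
        fix i j assume ij: "i \<in> p" "j \<in> p" "i \<noteq> j"
        have "interior (snd i) \<inter> interior (snd j) = {}"
          using p(5)[of "fst i" "snd i" "fst j" "snd j"] ij by auto
        moreover have "interior (snd i) = {u i<..<v i}" "interior (snd j) = {u j<..<v j}"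
          using K[OF ij(1)] K[OF ij(2)] interior_atLeastAtMost_real by metis+
        ultimately show "{u i<..<v i} \<inter> {u j<..<v j} = {}" by simp
      qed
      define pS where "pS = {i \<in> p. fst i \<in> S}"
      have pS: "finite pS" "pS \<subseteq> p" using p(1) by (auto simp: pS_def)
      have tag_bound: "\<bar>(v i - u i) * f' (fst i) - (f (v i) - f (u i))\<bar>
          \<le> e/2 * (v i - u i) + (if i \<in> pS then \<bar>f (v i) - f (u i)\<bar> else 0)" if i: "i \<in> p" for i
      proof (cases "fst i \<in> S")
        case True
        then have "i \<in> pS" using i by (simp add: pS_def)
        moreover have "0 \<le> e/2 * (v i - u i)"
          using K[OF i] e2 by (intro mult_nonneg_nonneg) auto
        ultimately show ?thesis
          using zero[OF True] by (simp add: abs_minus_commute)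
      next
        case False
        let ?x = "fst i"
        have "u i \<in> ball ?x (d ?x)" "v i \<in> ball ?x (d ?x)"
          using K[OF i] False by (auto simp: \<gamma>_def subset_iff simp del: mem_ball)
        then have "\<bar>f (u i) - f ?x - f' ?x * (u i - ?x)\<bar> \<le> e/2 * \<bar>u i - ?x\<bar>"
          "\<bar>f (v i) - f ?x - f' ?x * (v i - ?x)\<bar> \<le> e/2 * \<bar>v i - ?x\<bar>"
          by (intro d(2); use K[OF i] False in \<open>auto simp: dist_real_def\<close>)+
        moreover have "\<bar>(v i - u i) * f' ?x - (f (v i) - f (u i))\<bar>
            \<le> \<bar>f (u i) - f ?x - f' ?x * (u i - ?x)\<bar> + \<bar>f (v i) - f ?x - f' ?x * (v i - ?x)\<bar>"
          using abs_triangle_ineq4[of "f (u i) - f ?x - f' ?x * (u i - ?x)"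
              "f (v i) - f ?x - f' ?x * (v i - ?x)"]
          by (simp add: algebra_simps)
        moreover have "e/2 * \<bar>u i - ?x\<bar> + e/2 * \<bar>v i - ?x\<bar> = e/2 * (v i - u i)"
          using K[OF i] by (simp add: algebra_simps add_divide_distrib diff_divide_distrib)
        ultimately show ?thesis
          using False by (simp add: pS_def)
      qed
      have "(\<Sum>i\<in>pS. v i - u i) \<le> measure lebesgue U"
      proof (rule sum_lengths_le_measure)
        show "disjoint_family_on (\<lambda>i. {u i<..<v i}) pS"
          using disj pS(2) by (rule disjoint_family_on_mono[rotated])
        show "{u i<..<v i} \<subseteq> U" if "i \<in> pS" for i
          using K[of i] that by (auto simp: pS_def \<gamma>_def subset_iff)
        show "u i \<le> v i" if "i \<in> pS" for i
          using K[of i] that by (auto simp: pS_def)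
      qed (use pS U in auto)
      then have AC: "(\<Sum>i\<in>pS. \<bar>f (v i) - f (u i)\<bar>) < e/2 * (b - a)"
      proof (intro \<delta>)
        show "a \<le> u i \<and> u i \<le> v i \<and> v i \<le> b" if "i \<in> pS" for i
          using K[of i] that by (auto simp: pS_def)
        show "disjoint_family_on (\<lambda>i. {u i<..<v i}) pS"
          using disj pS(2) by (rule disjoint_family_on_mono[rotated])
      qed (use pS U in auto)
      have total: "(\<Sum>i\<in>p. g (v i) - g (u i)) = g b - g a" for g :: "real \<Rightarrow> real"
        using additive_tagged_division_1[OF \<open>a \<le> b\<close> ptag, of g]
        by (simp add: u_def v_def case_prod_beta)
      have "(\<Sum>(x,k)\<in>p. measure lborel k *\<^sub>R f' x) = (\<Sum>i\<in>p. (v i - u i) * f' (fst i))"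
      proof (rule sum.cong)
        fix i assume i: "i \<in> p"
        have "measure lborel (snd i) = v i - u i"
          using K[OF i] by auto
        then show "(case i of (x, k) \<Rightarrow> measure lborel k *\<^sub>R f' x) = (v i - u i) * f' (fst i)"
          by (simp add: case_prod_beta)
      qed simp
      then have "norm ((\<Sum>(x,k)\<in>p. measure lborel k *\<^sub>R f' x) - (f b - f a))
          = \<bar>\<Sum>i\<in>p. (v i - u i) * f' (fst i) - (f (v i) - f (u i))\<bar>"
        by (simp only: total[of f, symmetric] sum_subtractf real_norm_def)
      also have "\<dots> \<le> (\<Sum>i\<in>p. \<bar>(v i - u i) * f' (fst i) - (f (v i) - f (u i))\<bar>)"
        by (rule sum_abs)
      also have "\<dots> \<le> (\<Sum>i\<in>p. e/2 * (v i - u i) + (if i \<in> pS then \<bar>f (v i) - f (u i)\<bar> else 0))"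
        by (rule sum_mono) (rule tag_bound)
      also have "\<dots> = e/2 * (\<Sum>i\<in>p. v i - u i) + (\<Sum>i\<in>pS. \<bar>f (v i) - f (u i)\<bar>)"
        unfolding sum.distrib sum_distrib_left[symmetric]
        using p(1) pS by (simp add: sum.If_cases Int_absorb1)
      also have "\<dots> \<le> e/2 * (b - a) + e/2 * (b - a)"
        using total[of "\<lambda>x. x"] AC by simp
      finally show ?thesis
        using \<open>a \<le> b\<close> by simp
    qed
    show "\<exists>d. gauge d \<and> (\<forall>p. p tagged_division_of {a..b} \<and> d fine p \<longrightarrow>
        norm ((\<Sum>(x,k)\<in>p. measure lborel k *\<^sub>R f' x) - (f b - f a)) \<le> e * measure lborel {a..b})"
      using gauge bound by (intro exI[of _ \<gamma>] conjI allI impI) simp_all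
  qed
qed (use \<open>a \<le> b\<close> in auto)

lemma abs_continuous_deriv_has_integral:
  fixes f :: "real \<Rightarrow> real"
  assumes "abs_continuous_on_interval a b f" and "a \<le> b"
  shows "(deriv f has_integral (f b - f a)) {a..b}"
proof -
  define S where "S = {x \<in> {a..b}. \<not> f differentiable (at x)}"
  have S: "negligible S"
    using abs_continuous_ae_differentiable[OF assms] by (simp add: S_def)
  have "((\<lambda>x. if x \<in> S then 0 else deriv f x) has_integral (f b - f a)) {a..b}"
  proof (rule abs_continuous_has_integral_ae_deriv[OF assms S])
    fix x assume x: "x \<in> {a..b} - S"
    then have "(f has_real_derivative deriv f x) (at x)"
      by (simp add: S_def DERIV_deriv_iff_real_differentiable)
    then show "(f has_real_derivative (if x \<in> S then 0 else deriv f x)) (at x within {a..b})"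
      using x by (auto intro: has_field_derivative_at_within)
  qed auto
  then show ?thesis
    by (rule has_integral_spike[OF S, rotated]) auto
qed

lemma abs_continuous_on_subinterval:
  assumes "abs_continuous_on_interval a b f" "a \<le> c" "d \<le> b"
  shows "abs_continuous_on_interval c d f"
  using assms unfolding abs_continuous_on_interval_def by (meson order_trans)

text \<open>The integrals of \<open>deriv f\<close> over the pieces of a division are increments of \<open>f\<close>, so their absolute
values add up to at most the variation of \<open>f\<close>.\<close>

lemma abs_continuous_deriv_absolutely_integrable:
  fixes f :: "real \<Rightarrow> real"
  assumes ac: "abs_continuous_on_interval a b f" and "a \<le> b"
  shows "deriv f absolutely_integrable_on {a..b}"
proof -
  obtain B where B: "\<And>(I :: real set set) u v.
      \<lbrakk>finite I; \<And>i. i \<in> I \<Longrightarrow> a \<le> u i \<and> u i \<le> v i \<and> v i \<le> b;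
       disjoint_family_on (\<lambda>i. {u i<..<v i}) I\<rbrakk>
      \<Longrightarrow> (\<Sum>i\<in>I. \<bar>f (v i) - f (u i)\<bar>) \<le> B"
    using abs_continuous_bounded_variation[OF assms] by blast
  have "deriv f absolutely_integrable_on cbox a b"
  proof (rule bounded_variation_absolutely_integrable_interval)
    show "deriv f integrable_on cbox a b"
      using abs_continuous_deriv_has_integral[OF assms] by (auto simp: integrable_on_def)
    fix d assume d: "d division_of cbox a b"
    note D = division_ofD[OF d]
    have K: "K = {Inf K..Sup K} \<and> a \<le> Inf K \<and> Inf K \<le> Sup K \<and> Sup K \<le> b" if K: "K \<in> d" for K
    proof -
      obtain s t where "K = {s..t}"
        using D(4)[OF K] by (auto simp: cbox_interval)
      then show ?thesis
        using D(2,3)[OF K] by auto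
    qed
    have "(\<Sum>K\<in>d. norm (integral K (deriv f))) = (\<Sum>K\<in>d. \<bar>f (Sup K) - f (Inf K)\<bar>)"
    proof (rule sum.cong)
      fix K assume "K \<in> d"
      note K = K[OF this]
      then have "(deriv f has_integral (f (Sup K) - f (Inf K))) {Inf K..Sup K}"
        by (intro abs_continuous_deriv_has_integral abs_continuous_on_subinterval[OF ac]) auto
      then show "norm (integral K (deriv f)) = \<bar>f (Sup K) - f (Inf K)\<bar>"
        using K by (metis integral_unique real_norm_def)
    qed simp
    also have "\<dots> \<le> B"
    proof (rule B)
      show "disjoint_family_on (\<lambda>K. {Inf K<..<Sup K}) d"
        unfolding disjoint_family_on_def
      proof (intro ballI impI)
        fix K L assume KL: "K \<in> d" "L \<in> d" "K \<noteq> L"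
        then have "interior K \<inter> interior L = {}"
          by (rule D(5))
        moreover have "interior K = {Inf K<..<Sup K}" "interior L = {Inf L<..<Sup L}"
          using K[OF KL(1)] K[OF KL(2)] interior_atLeastAtMost_real by metis+
        ultimately show "{Inf K<..<Sup K} \<inter> {Inf L<..<Sup L} = {}" by simp
      qed
    qed (use D(1) K in auto)
    finally show "(\<Sum>K\<in>d. norm (integral K (deriv f))) \<le> B" .
  qed
  then show ?thesis by simp
qed

section \<open>Composition of fractional integrals\<close>

text \<open>The substitution \<open>s = r + (t - r) z\<close> turns this into the Beta integral on \<open>[0, 1]\<close>. The two exponents
add up to \<open>-1\<close>, so the powers of \<open>t - r\<close> cancel and the value does not depend on \<open>r\<close> and \<open>t\<close>.\<close>

lemma has_integral_Beta_kernel: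
  fixes \<alpha> r t :: real
  assumes "0 < \<alpha>" "\<alpha> < 1" "r < t"
  shows "((\<lambda>s. (t - s) powr (\<alpha> - 1) * (s - r) powr (-\<alpha>)) has_integral Gamma \<alpha> * Gamma (1 - \<alpha>)) {r..t}"
proof -
  define h where "h = t - r"
  have "h > 0" using assms by (simp add: h_def)
  define f where "f z = z powr (1 - \<alpha> - 1) * (1 - z) powr (\<alpha> - 1)" for z
  have "(f has_integral Beta (1 - \<alpha>) \<alpha>) (cbox 0 1)"
    unfolding f_def cbox_interval using assms by (intro has_integral_Beta_real) auto
  then have f: "(f has_integral Gamma \<alpha> * Gamma (1 - \<alpha>)) (cbox 0 1)"
    by (simp add: Beta_def mult.commute)
  have ends: "(0 - - r / h) * h = r" "(1 - - r / h) * h = t"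
    using \<open>h > 0\<close> by (auto simp: h_def field_simps)
  have "((\<lambda>s. f (1 / h * s + - r / h)) has_integral (Gamma \<alpha> * Gamma (1 - \<alpha>)) * h) {r..t}"
    using has_integral_affinity'[OF f, of "1 / h" "- r / h"] \<open>h > 0\<close> ends
    by (simp add: cbox_interval mult_ac)
  from has_integral_mult_right[OF this, of "1 / h"]
  have "((\<lambda>s. 1 / h * f (1 / h * s + - r / h)) has_integral Gamma \<alpha> * Gamma (1 - \<alpha>)) {r..t}"
    using \<open>h > 0\<close> by simp
  moreover have "1 / h * f (1 / h * s + - r / h) = (t - s) powr (\<alpha> - 1) * (s - r) powr (-\<alpha>)"
    if "s \<in> {r..t}" for s
  proof -
    have "1 / h * s + - r / h = (s - r) / h"
      by (simp add: diff_divide_distrib)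
    moreover have "1 - (s - r) / h = (t - s) / h"
      using \<open>h > 0\<close> by (simp add: h_def field_simps)
    ultimately have "f (1 / h * s + - r / h) = ((s - r) / h) powr (-\<alpha>) * ((t - s) / h) powr (\<alpha> - 1)"
      by (simp add: f_def)
    also have "\<dots> = (t - s) powr (\<alpha> - 1) * (s - r) powr (-\<alpha>) / (h powr (-\<alpha>) * h powr (\<alpha> - 1))"
      using that \<open>h > 0\<close> by (simp add: powr_divide)
    also have "h powr (-\<alpha>) * h powr (\<alpha> - 1) = 1 / h"
      using powr_add[of h "-\<alpha>" "\<alpha> - 1"] \<open>h > 0\<close> by (simp add: powr_neg_one)
    finally show ?thesis
      using \<open>h > 0\<close> by simp
  qed
  ultimately show ?thesis
    by (rule has_integral_eq[rotated])
qed

text \<open>Fubini's theorem is used for the product of two copies of Borel--Lebesgue measure, which calls for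
Borel measurable integrands.\<close>

lemma integrable_lebesgue_borel_representative:
  fixes f :: "real \<Rightarrow> real"
  assumes "integrable lebesgue f"
  obtains g where "integrable lborel g" "AE x in lebesgue. f x = g x"
proof -
  obtain g where g: "g \<in> borel_measurable lborel" "AE x in lborel. f x = g x"
    using completion_ex_borel_measurable_real[OF borel_measurable_integrable[OF assms]] by blast
  have AE: "AE x in lebesgue. f x = g x"
    using g(2) by (rule AE_completion)
  have "g \<in> borel_measurable lebesgue"
    using g(1) by (simp add: measurable_completion)
  then have "integrable lebesgue g"
    using assms AE integrable_cong_AE[of f lebesgue g] by auto
  then have "integrable lborel g"
    using integrable_completion[OF g(1)] by simp
  then show ?thesis
    using that AE by blast
qed

text \<open>The composition \<open>I\<^sup>\<alpha> I\<^bsup>1-\<alpha>\<^esup> = I\<^sup>1\<close>, by exchanging the order of integration over the triangle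
\<open>0 \<le> r \<le> s \<le> t\<close>.\<close>

lemma RL_integral_inversion:
  fixes y :: "real \<Rightarrow> real"
  assumes \<alpha>: "0 < \<alpha>" "\<alpha> < 1" and y: "y absolutely_integrable_on {0..t}"
  shows "((\<lambda>s. (t - s) powr (\<alpha> - 1) * RL_integral (1 - \<alpha>) y s) has_integral
           Gamma \<alpha> * integral {0..t} y) {0..t}"
proof -
  have Gamma_pos: "Gamma \<alpha> > 0" "Gamma (1 - \<alpha>) > 0"
    using \<alpha> by (auto intro: Gamma_real_pos)
  define B where "B = Gamma \<alpha> * Gamma (1 - \<alpha>)"
  have "integrable lebesgue (\<lambda>x. indicator {0..t} x * y x)"
    using y by (simp add: set_integrable_def)
  then obtain w where w: "integrable lborel w" "AE x in lebesgue. indicator {0..t} x * y x = w x"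
    using integrable_lebesgue_borel_representative by blast
  have w_meas[measurable]: "w \<in> borel_measurable borel"
    using w(1) by auto
  \<comment> \<open>The kernel on the triangle. The edges \<open>s = r\<close> and \<open>s = t\<close> are harmless since \<open>0 powr a = 0\<close>; the
    corner \<open>r = t\<close> is removed because the Beta integral needs a nondegenerate interval.\<close>
  define k where "k r s = (if 0 \<le> r \<and> r < t \<and> r \<le> s \<and> s \<le> t
      then (t - s) powr (\<alpha> - 1) * (s - r) powr (-\<alpha>) else 0)" for r s
  have k_nonneg: "0 \<le> k r s" for r s by (simp add: k_def)
  have k_meas[measurable]: "(\<lambda>z. k (fst z) (snd z)) \<in> borel_measurable (lborel \<Otimes>\<^sub>M lborel)"
    unfolding k_def by measurable
  have k_meas2[measurable]: "(\<lambda>s. k r s) \<in> borel_measurable borel" for r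
    unfolding k_def by measurable
  \<comment> \<open>Integrating the kernel over the intermediate variable gives a constant.\<close>
  have k_int: "has_bochner_integral lborel (\<lambda>s. k r s) (B * indicator {0..<t} r)" for r
  proof (cases "r \<in> {0..<t}")
    case True
    have "((\<lambda>s. (t - s) powr (\<alpha> - 1) * (s - r) powr (-\<alpha>)) has_integral B) {r..t}"
      unfolding B_def using True by (intro has_integral_Beta_kernel \<alpha>) auto
    then have "((\<lambda>s. if s \<in> {r..t} then (t - s) powr (\<alpha> - 1) * (s - r) powr (-\<alpha>) else 0)
        has_integral B) UNIV"
      by (simp only: has_integral_restrict_UNIV)
    moreover have "k r = (\<lambda>s. if s \<in> {r..t} then (t - s) powr (\<alpha> - 1) * (s - r) powr (-\<alpha>) else 0)"
      using True by (auto simp: k_def)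
    ultimately have "integral\<^sup>N lborel (\<lambda>s. ennreal (k r s)) = ennreal B"
      using k_nonneg by (intro nn_integral_has_integral_lborel) auto
    moreover have "B \<ge> 0"
      using Gamma_pos by (simp add: B_def)
    ultimately show ?thesis
      using True k_nonneg by (intro has_bochner_integral_nn_integral) auto
  next
    case False
    then have "k r = (\<lambda>_. 0)" by (auto simp: k_def)
    then show ?thesis using False by (simp add: has_bochner_integral_zero)
  qed
  define K where "K z = k (fst z) (snd z) * w (fst z)" for z
  have K_meas[measurable]: "K \<in> borel_measurable (lborel \<Otimes>\<^sub>M lborel)"
    unfolding K_def by measurable
  have w_int: "integrable lborel (\<lambda>r. B * indicator {0..<t} r * w r)"
    using integrable_mult_indicator[OF _ w(1), of "{0..<t}"] by (simp add: mult.assoc)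
  have K_int: "integrable (lborel \<Otimes>\<^sub>M lborel) K"
  proof (rule lborel_pair.Fubini_integrable)
    have "(\<integral>s. norm (K (r, s)) \<partial>lborel) = B * indicator {0..<t} r * \<bar>w r\<bar>" for r
      using has_bochner_integral_integral_eq[OF k_int[of r]] k_nonneg
      by (simp add: K_def abs_mult)
    then show "integrable lborel (\<lambda>r. \<integral>s. norm (K (r, s)) \<partial>lborel)"
      using integrable_norm[OF w_int] Gamma_pos
      by (simp add: abs_mult B_def)
    show "AE r in lborel. integrable lborel (\<lambda>s. K (r, s))"
      using k_int by (auto simp: K_def has_bochner_integral_iff)
  qed simp
  have "(\<integral>s. (\<integral>r. K (r, s) \<partial>lborel) \<partial>lborel) = (\<integral>r. (\<integral>s. K (r, s) \<partial>lborel) \<partial>lborel)"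
    using lborel_pair.Fubini_integral[of "\<lambda>r s. K (r, s)"] K_int by simp
  also have "\<dots> = (\<integral>r. B * (indicator {0..<t} r * w r) \<partial>lborel)"
    using has_bochner_integral_integral_eq[OF k_int] by (simp add: K_def mult.assoc)
  also have "\<dots> = B * (\<integral>r. indicator {0..<t} r * w r \<partial>lborel)"
    by simp
  also have "(\<integral>r. indicator {0..<t} r * w r \<partial>lborel) = (\<integral>r. indicator {0..<t} r * w r \<partial>lebesgue)"
    by (rule integral_completion[symmetric]) measurable
  also have "\<dots> = (\<integral>r. indicator {0..t} r * y r \<partial>lebesgue)"
  proof (rule integral_cong_AE)
    have "AE r in lebesgue. r \<noteq> t"
      by (rule AE_completion) (rule AE_lborel_singleton)
    then show "AE r in lebesgue. indicator {0..<t} r * w r = indicator {0..t} r * y r"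
      using w(2)
    proof eventually_elim
      case (elim r)
      then have "indicator {0..<t} r = (indicator {0..t} r :: real)"
        by (auto simp: indicator_def)
      with elim(2)[symmetric] show ?case
        by (simp add: indicator_def)
    qed
    show "(\<lambda>r. indicator {0..<t} r * w r) \<in> borel_measurable lebesgue"
      by (rule measurable_completion) measurable
    show "(\<lambda>r. indicator {0..t} r * y r) \<in> borel_measurable lebesgue"
      using \<open>integrable lebesgue (\<lambda>x. indicator {0..t} x * y x)\<close> by (rule borel_measurable_integrable)
  qed
  also have "\<dots> = integral {0..t} y"
    using set_lebesgue_integral_eq_integral(2)[OF y] by (simp add: set_lebesgue_integral_def)
  finally have total: "(\<integral>s. (\<integral>r. K (r, s) \<partial>lborel) \<partial>lborel) = B * integral {0..t} y" .
  have inner: "(\<integral>r. K (r, s) \<partial>lborel) =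
      (if s \<in> {0..t} then Gamma (1 - \<alpha>) * ((t - s) powr (\<alpha> - 1) * RL_integral (1 - \<alpha>) y s) else 0)" for s
  proof (cases "s \<in> {0..<t}")
    case True
    have "(\<integral>r. K (r, s) \<partial>lborel)
        = (\<integral>r. (t - s) powr (\<alpha> - 1) * (indicator {0..s} r * (s - r) powr (-\<alpha>) * w r) \<partial>lborel)"
      using True by (intro Bochner_Integration.integral_cong) (auto simp: K_def k_def indicator_def)
    also have "\<dots> = (t - s) powr (\<alpha> - 1) * (\<integral>r. indicator {0..s} r * (s - r) powr (-\<alpha>) * w r \<partial>lborel)"
      by simp
    also have "(\<integral>r. indicator {0..s} r * (s - r) powr (-\<alpha>) * w r \<partial>lborel)
        = (\<integral>r. indicator {0..s} r * (s - r) powr (-\<alpha>) * w r \<partial>lebesgue)"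
      by (rule integral_completion[symmetric]) measurable
    also have "\<dots> = (\<integral>r. indicator {0..s} r * (s - r) powr (-\<alpha>) * (indicator {0..t} r * y r) \<partial>lebesgue)"
    proof (rule integral_cong_AE)
      show "AE r in lebesgue. indicator {0..s} r * (s - r) powr (-\<alpha>) * w r =
          indicator {0..s} r * (s - r) powr (-\<alpha>) * (indicator {0..t} r * y r)"
        using w(2) by eventually_elim simp
      show "(\<lambda>r. indicator {0..s} r * (s - r) powr (-\<alpha>) * w r) \<in> borel_measurable lebesgue"
        by (rule measurable_completion) measurable
      have "(\<lambda>r. indicator {0..s} r * (s - r) powr (-\<alpha>)) \<in> borel_measurable lebesgue"
        by (rule measurable_completion) measurable
      then show "(\<lambda>r. indicator {0..s} r * (s - r) powr (-\<alpha>) * (indicator {0..t} r * y r)) \<in> borel_measurable lebesgue"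
        using borel_measurable_integrable[OF \<open>integrable lebesgue (\<lambda>x. indicator {0..t} x * y x)\<close>]
        by (rule borel_measurable_times)
    qed
    also have "\<dots> = (\<integral>r. indicator {0..s} r * ((s - r) powr (1 - \<alpha> - 1) * y r) \<partial>lebesgue)"
      using True by (intro Bochner_Integration.integral_cong) (auto simp: indicator_def)
    also have "\<dots> = Gamma (1 - \<alpha>) * RL_integral (1 - \<alpha>) y s"
      using Gamma_pos by (simp add: RL_integral_def set_lebesgue_integral_def)
    finally show ?thesis
      using True by (simp add: mult_ac)
  next
    case False
    then have "K (r, s) = 0" for r by (auto simp: K_def k_def)
    then show ?thesis using False by auto
  qed
  have "integrable lborel (\<lambda>s. \<integral>r. K (r, s) \<partial>lborel)"
    using lborel_pair.integrable_snd[of "\<lambda>r s. K (r, s)"] K_int by simp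
  then have "((\<lambda>s. \<integral>r. K (r, s) \<partial>lborel) has_integral B * integral {0..t} y) UNIV"
    using has_integral_integral_lborel total by metis
  then have "((\<lambda>s. Gamma (1 - \<alpha>) * ((t - s) powr (\<alpha> - 1) * RL_integral (1 - \<alpha>) y s))
      has_integral B * integral {0..t} y) {0..t}"
    unfolding inner has_integral_restrict_UNIV .
  then have "((\<lambda>s. 1 / Gamma (1 - \<alpha>) * (Gamma (1 - \<alpha>) * ((t - s) powr (\<alpha> - 1) * RL_integral (1 - \<alpha>) y s)))
      has_integral 1 / Gamma (1 - \<alpha>) * (B * integral {0..t} y)) {0..t}"
    by (rule has_integral_mult_right)
  then show ?thesis
    using Gamma_pos by (simp add: B_def)
qed

section \<open>Averages against the power kernel\<close>

lemma continuous_extends_to_0_bounded: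
  assumes "continuous_extends_to_0 g"
  shows "bounded (g ` {0..T})"
proof -
  obtain l where "(g \<longlongrightarrow> l) (at_right 0)"
    using assms by (auto simp: continuous_extends_to_0_def)
  then have "\<forall>\<^sub>F s in at_right 0. dist (g s) l < 1"
    by (rule tendstoD) simp
  then obtain d where d: "d > 0" "\<And>s. 0 < s \<Longrightarrow> s < d \<Longrightarrow> dist (g s) l < 1"
    by (auto simp: eventually_at_right_field)
  have "bounded (g ` {0<..<d})"
    by (rule bounded_subset[OF bounded_ball[of l 1]]) (auto simp: dist_commute[of l] intro: d(2))
  moreover have "bounded (g ` {d..T})"
  proof (intro compact_imp_bounded compact_continuous_image)
    show "continuous_on {d..T} g"
      using assms d(1) unfolding continuous_extends_to_0_def
      by (auto elim: continuous_on_subset)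
  qed simp
  ultimately have "bounded (insert (g 0) (g ` {0<..<d} \<union> g ` {d..T}))"
    by simp
  moreover have "{0..T} \<subseteq> insert 0 ({0<..<d} \<union> {d..T})"
    by auto
  then have "g ` {0..T} \<subseteq> insert (g 0) (g ` {0<..<d} \<union> g ` {d..T})"
    by blast
  ultimately show ?thesis
    by (rule bounded_subset)
qed

lemma has_integral_powr_kernel:
  fixes \<alpha> T t :: real
  assumes "0 < \<alpha>" "0 \<le> T" "T \<le> t"
  shows "((\<lambda>s. (t - s) powr (\<alpha> - 1)) has_integral (t powr \<alpha> - (t - T) powr \<alpha>) / \<alpha>) {0..T}"
proof -
  have "((\<lambda>s. (t - s) powr (\<alpha> - 1)) has_integral - ((t - T) powr \<alpha>) / \<alpha> - - ((t - 0) powr \<alpha>) / \<alpha>) {0..T}"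
  proof (rule fundamental_theorem_of_calculus_interior[OF \<open>0 \<le> T\<close>])
    show "continuous_on {0..T} (\<lambda>s. - ((t - s) powr \<alpha>) / \<alpha>)"
      using assms by (intro continuous_intros continuous_on_powr') auto
    fix s assume "s \<in> {0<..<T}"
    then show "((\<lambda>s. - ((t - s) powr \<alpha>) / \<alpha>) has_vector_derivative (t - s) powr (\<alpha> - 1)) (at s)"
      using assms unfolding has_real_derivative_iff_has_vector_derivative[symmetric]
      by (auto intro!: derivative_eq_intros simp: field_simps powr_diff)
  qed
  then show ?thesis
    by (simp add: diff_divide_distrib)
qed

text \<open>Compare \<open>g\<close> with the step function that is \<open>c - M\<close> on \<open>[0, T]\<close> and \<open>c\<close> afterwards.\<close>

lemma kernel_integral_lower_bound:
  fixes \<alpha> T t :: real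
  assumes "0 < \<alpha>" "0 \<le> T" "T \<le> t"
    and large: "\<And>s. T < s \<Longrightarrow> c \<le> g s"
    and small: "\<And>s. s \<in> {0..T} \<Longrightarrow> c - M \<le> g s"
    and I: "((\<lambda>s. (t - s) powr (\<alpha> - 1) * g s) has_integral I) {0..t}"
  shows "c * t powr \<alpha> - M * (t powr \<alpha> - (t - T) powr \<alpha>) \<le> \<alpha> * I"
proof -
  let ?k = "\<lambda>s. (t - s) powr (\<alpha> - 1)"
  have "(?k has_integral t powr \<alpha> / \<alpha>) {0..t}"
    using has_integral_powr_kernel[of \<alpha> t t] assms by simp
  moreover have "((\<lambda>s. if s \<in> {0..T} then ?k s else 0) has_integral (t powr \<alpha> - (t - T) powr \<alpha>) / \<alpha>) {0..t}"
    using has_integral_powr_kernel[of \<alpha> T t] assms by (subst has_integral_restrict) auto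
  ultimately have "((\<lambda>s. c * ?k s - M * (if s \<in> {0..T} then ?k s else 0)) has_integral
      c * (t powr \<alpha> / \<alpha>) - M * ((t powr \<alpha> - (t - T) powr \<alpha>) / \<alpha>)) {0..t}"
    by (intro has_integral_diff has_integral_mult_right)
  then have "c * (t powr \<alpha> / \<alpha>) - M * ((t powr \<alpha> - (t - T) powr \<alpha>) / \<alpha>) \<le> I"
  proof (rule has_integral_le[OF _ I])
    fix s assume s: "s \<in> {0..t}"
    show "c * ?k s - M * (if s \<in> {0..T} then ?k s else 0) \<le> ?k s * g s"
    proof (cases "s \<in> {0..T}")
      case True
      then show ?thesis
        using mult_left_mono[OF small[OF True], of "?k s"] by (simp add: algebra_simps)
    next
      case False
      then show ?thesis
        using mult_left_mono[OF large[of s], of "?k s"] s by (simp add: algebra_simps)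
    qed
  qed
  then have "\<alpha> * (c * (t powr \<alpha> / \<alpha>) - M * ((t powr \<alpha> - (t - T) powr \<alpha>) / \<alpha>)) \<le> \<alpha> * I"
    using \<open>0 < \<alpha>\<close> by (intro mult_left_mono) auto
  moreover have "\<alpha> * (c * (t powr \<alpha> / \<alpha>) - M * ((t powr \<alpha> - (t - T) powr \<alpha>) / \<alpha>))
      = c * t powr \<alpha> - M * (t powr \<alpha> - (t - T) powr \<alpha>)"
    using \<open>0 < \<alpha>\<close> by (simp add: field_simps)
  ultimately show ?thesis by simp
qed

text \<open>The normalised kernel \<open>\<alpha> (t - s)\<^bsup>\<alpha>-1\<^esup> / t\<^sup>\<alpha>\<close> is a probability density on \<open>[0, t]\<close> and gives the initial
segment \<open>[0, T]\<close> the weight \<open>1 - (1 - T/t)\<^sup>\<alpha>\<close>, which tends to \<open>0\<close>. A lower bound for \<open>g\<close> near infinity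
therefore survives averaging, up to an arbitrarily small loss.\<close>

lemma kernel_average_eventually_greater:
  fixes \<alpha> :: real
  assumes "0 < \<alpha>" and bdd: "\<And>T. bounded (g ` {0..T})"
    and I: "\<And>t. 0 < t \<Longrightarrow> ((\<lambda>s. (t - s) powr (\<alpha> - 1) * g s) has_integral I t) {0..t}"
    and ev: "\<forall>\<^sub>F s in at_top. c \<le> g s" and "c' < c"
  shows "\<forall>\<^sub>F t in at_top. c' < \<alpha> * I t / t powr \<alpha>"
proof -
  obtain T0 where T0: "\<And>s. T0 \<le> s \<Longrightarrow> c \<le> g s"
    using ev by (auto simp: eventually_at_top_linorder)
  define T where "T = max 0 T0"
  obtain b where b: "\<forall>s\<in>{0..T}. \<bar>g s\<bar> \<le> b"
    using bdd[of T] by (auto simp: bounded_iff)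
  \<comment> \<open>Chosen so that \<open>c - M = -b\<close> bounds \<open>g\<close> from below on \<open>[0, T]\<close>.\<close>
  define M where "M = b + c"
  have bound: "c - M * (1 - (1 - T / t) powr \<alpha>) \<le> \<alpha> * I t / t powr \<alpha>" if t: "T < t" for t
  proof -
    have "t > 0" using t by (simp add: T_def)
    have "c * t powr \<alpha> - M * (t powr \<alpha> - (t - T) powr \<alpha>) \<le> \<alpha> * I t"
    proof (rule kernel_integral_lower_bound[OF \<open>0 < \<alpha>\<close> _ _ _ _ I[OF \<open>t > 0\<close>]])
      show "c - M \<le> g s" if "s \<in> {0..T}" for s
        using bspec[OF b that] by (simp add: M_def)
    qed (use t T0 in \<open>auto simp: T_def\<close>)
    then have "(c * t powr \<alpha> - M * (t powr \<alpha> - (t - T) powr \<alpha>)) / t powr \<alpha> \<le> \<alpha> * I t / t powr \<alpha>"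
      by (rule divide_right_mono) simp
    moreover have "(1 - T / t) powr \<alpha> = (t - T) powr \<alpha> / t powr \<alpha>"
      using t \<open>t > 0\<close> powr_divide[of "t - T" t \<alpha>] by (simp add: diff_divide_distrib)
    ultimately show ?thesis
      using \<open>t > 0\<close> by (simp add: diff_divide_distrib right_diff_distrib)
  qed
  have "((\<lambda>t::real. T / t) \<longlongrightarrow> 0) at_top"
    by (intro tendsto_divide_0[OF tendsto_const] filterlim_at_top_imp_at_infinity filterlim_ident)
  then have "((\<lambda>t. c - M * (1 - (1 - T / t) powr \<alpha>)) \<longlongrightarrow> c - M * (1 - (1 - 0) powr \<alpha>)) at_top"
    by (intro tendsto_intros) auto
  then have "\<forall>\<^sub>F t in at_top. c' < c - M * (1 - (1 - T / t) powr \<alpha>)"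
    using \<open>c' < c\<close> by (intro order_tendstoD) auto
  then show ?thesis
    using eventually_gt_at_top[of T]
    by eventually_elim (use bound in force)
qed

section \<open>Growth of a function and its Caputo derivative\<close>

theorem lemma2p11:
  fixes \<alpha> \<eta> :: real and x :: "real \<Rightarrow> real" and L :: ereal
  assumes "0 < \<alpha>" and "\<alpha> < 1"
    and "0 \<le> \<eta>" and "\<eta> < 1"
    and "x \<in> AC_halfline"
    and "RL_integral (1 - \<alpha>) (deriv x) \<in> C1_weighted \<eta>"
    and "((\<lambda>\<tau>. ereal (caputo_deriv \<alpha> x \<tau> / Gamma (1 + \<alpha>))) \<longlongrightarrow> L) at_top"
  shows "((\<lambda>\<tau>. ereal (x \<tau> / \<tau> powr \<alpha>)) \<longlongrightarrow> L) at_top"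
proof -
  define g where "g = caputo_deriv \<alpha> x"
  define \<Gamma> where "\<Gamma> = Gamma (1 + \<alpha>)"
  have "\<Gamma> > 0"
    using assms(1) by (auto simp: \<Gamma>_def intro: Gamma_real_pos)
  have \<Gamma>: "\<Gamma> = \<alpha> * Gamma \<alpha>"
    using Gamma_plus1[of \<alpha>] nonpos_Ints_nonpos[of \<alpha>] assms(1)
    by (force simp: \<Gamma>_def add.commute)
  have lim: "((\<lambda>t. ereal (g t / \<Gamma>)) \<longlongrightarrow> L) at_top"
    using assms(7) by (simp add: g_def \<Gamma>_def)
  have g_bdd: "bounded (g ` {0..T})" for T
  proof (rule continuous_extends_to_0_bounded)
    have "caputo_deriv \<alpha> x = RL_integral (1 - \<alpha>) (deriv x)"
      by (auto simp: caputo_deriv_def)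
    then show "continuous_extends_to_0 g"
      using assms(6) by (simp add: C1_weighted_def g_def)
  qed
  have inversion: "((\<lambda>s. (t - s) powr (\<alpha> - 1) * g s) has_integral Gamma \<alpha> * (x t - x 0)) {0..t}"
    if "t > 0" for t
  proof -
    have ac: "abs_continuous_on_interval 0 t x"
      using assms(5) that by (auto simp: AC_halfline_def)
    have "integral {0..t} (deriv x) = x t - x 0"
      using abs_continuous_deriv_has_integral[OF ac] that by (auto intro: integral_unique)
    then show ?thesis
      using RL_integral_inversion[OF assms(1,2) abs_continuous_deriv_absolutely_integrable[OF ac]] that
      by (simp add: g_def caputo_deriv_def)
  qed
  have x0: "((\<lambda>t. x 0 / t powr \<alpha>) \<longlongrightarrow> 0) at_top"
    using tendsto_mult[OF tendsto_const tendsto_neg_powr[OF _ filterlim_ident], of "-\<alpha>" "x 0"] assms(1)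
    by (simp add: powr_minus_divide)
  \<comment> \<open>The sign \<open>\<sigma>\<close> will be \<open>1\<close> for lower and \<open>-1\<close> for upper bounds. The loss from \<open>c\<close> to \<open>c'\<close> is
    split at \<open>m\<close>: one half for the averaging, the other for the initial value.\<close>
  have key: "\<forall>\<^sub>F t in at_top. c' < \<sigma> * (x t / t powr \<alpha>)"
    if "\<forall>\<^sub>F t in at_top. c < \<sigma> * (g t / \<Gamma>)" "c' < c" for c c' \<sigma> :: real
  proof -
    define m where "m = (c + c') / 2"
    have m: "c' < m" "m < c" using that(2) by (auto simp: m_def)
    have "\<forall>\<^sub>F t in at_top. m * \<Gamma> < \<alpha> * (\<sigma> * (Gamma \<alpha> * (x t - x 0))) / t powr \<alpha>"
    proof (rule kernel_average_eventually_greater[where g = "\<lambda>t. \<sigma> * g t" and c = "c * \<Gamma>"])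
      show "bounded ((\<lambda>t. \<sigma> * g t) ` {0..T})" for T
        using bounded_scaleR_comp[OF g_bdd[of T], of \<sigma>] by simp
      show "((\<lambda>s. (t - s) powr (\<alpha> - 1) * (\<sigma> * g s)) has_integral \<sigma> * (Gamma \<alpha> * (x t - x 0))) {0..t}"
        if "0 < t" for t
        using has_integral_mult_right[OF inversion[OF that], of \<sigma>] by (simp add: mult.left_commute)
      show "\<forall>\<^sub>F t in at_top. c * \<Gamma> \<le> \<sigma> * g t"
        using that(1) by eventually_elim (use \<open>\<Gamma> > 0\<close> in \<open>simp add: field_simps\<close>)
      show "m * \<Gamma> < c * \<Gamma>"
        using m(2) \<open>\<Gamma> > 0\<close> by simp
    qed (rule assms(1))
    moreover have "((\<lambda>t. \<sigma> * (x 0 / t powr \<alpha>)) \<longlongrightarrow> \<sigma> * 0) at_top"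
      by (intro tendsto_intros x0)
    then have "\<forall>\<^sub>F t in at_top. c' - m < \<sigma> * (x 0 / t powr \<alpha>)"
      using m by (intro order_tendstoD) auto
    ultimately show ?thesis
    proof eventually_elim
      case (elim t)
      have "\<alpha> * (\<sigma> * (Gamma \<alpha> * (x t - x 0))) / t powr \<alpha> = \<Gamma> * (\<sigma> * (x t / t powr \<alpha>) - \<sigma> * (x 0 / t powr \<alpha>))"
        by (simp add: \<Gamma> algebra_simps diff_divide_distrib)
      with elim(1) have "m < \<sigma> * (x t / t powr \<alpha>) - \<sigma> * (x 0 / t powr \<alpha>)"
        using \<open>\<Gamma> > 0\<close> by (simp add: mult.commute[of m])
      with elim(2) show ?case by simp
    qed
  qed
  show ?thesis
  proof (rule order_tendstoI)
    fix a assume "a < L"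
    then obtain c where c: "a < ereal c" "ereal c < L"
      using ereal_dense2 by blast
    then obtain c' where c': "a < ereal c'" "c' < c"
      using ereal_dense2[of a "ereal c"] by auto
    have "\<forall>\<^sub>F t in at_top. c < 1 * (g t / \<Gamma>)"
      using order_tendstoD(1)[OF lim c(2)] by simp
    from key[OF this c'(2)] show "\<forall>\<^sub>F t in at_top. a < ereal (x t / t powr \<alpha>)"
      by eventually_elim (rule less_trans[OF c'(1)], simp)
  next
    fix a assume "L < a"
    then obtain c where c: "L < ereal c" "ereal c < a"
      using ereal_dense2 by blast
    then obtain c' where c': "c < c'" "ereal c' < a"
      using ereal_dense2[of "ereal c" a] by auto
    have "\<forall>\<^sub>F t in at_top. - c < - 1 * (g t / \<Gamma>)"
      using order_tendstoD(2)[OF lim c(1)] by simp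
    from key[OF this, of "- c'"] c'(1) have "\<forall>\<^sub>F t in at_top. x t / t powr \<alpha> < c'"
      by simp
    then show "\<forall>\<^sub>F t in at_top. ereal (x t / t powr \<alpha>) < a"
      by eventually_elim (rule less_trans[OF _ c'(2)], simp)
  qed
qed

end
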